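(* Let $\beta\in(0,1)$, and let $d_0,d_1,s_0,s_1$ be real constants and $d_2,s_2\ge0$ with $d_1+s_1\neq0$ and $d_2+s_2\neq0$. Consider the price adjustment equation with Caputo fractal derivative (with agents' expectations) $${}^{C}_0\mathcal D^\beta p(S_F^\alpha(t))-\frac{d_1+s_1}{d_2+s_2}\,p(S_F^\alpha(t))=-\frac{d_0+s_0}{d_2+s_2}$$ with prescribed initial value $p(0)$. Its solution is $$p(S_F^\alpha(t))=p(0)\,E_\beta\!\left(\frac{d_1+s_1}{d_2+s_2}S_F^\alpha(t)^\beta\right)+\frac{d_0+s_0}{d_1+s_1}\left(1-E_\beta\!\left(\frac{d_1+s_1}{d_2+s_2}S_F^\alpha(t)^\beta\right)\right),$$ where $E_\beta(x)=\sum_{j=0}^\infty \frac{x^j}{\Gamma(\beta j+1)}$ is the (fractal) Mittag-Leffler function.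
   Context: Setting ($F^\alpha$-calculus). Let $0<\alpha\le 1$ and let $F\subset[0,\infty)$ be closed. For a subdivision $x=x_0<x_1<\dots<x_n=y$ of $[x,y]$ put $\sigma^\alpha=\sum_{i}\frac{(x_{i+1}-x_i)^\alpha}{\Gamma(\alpha+1)}\Theta(F,[x_i,x_{i+1}])$, where $\Theta(F,I)=1$ if $F\cap I\neq\emptyset$ and $0$ otherwise. Let $\gamma^\alpha(F,x,y)=\lim_{\delta\to0}\inf\sigma^\alpha$, the infimum being over subdivisions of mesh at most $\delta$. The integral staircase function is $S_F^\alpha(x)=\gamma^\alpha(F,0,x)$ for $x\ge0$. It is assumed that $S_F^\alpha$ is finite on $[0,\infty)$ (hence continuous and nondecreasing with $S_F^\alpha(0)=0$), that $S_F^\alpha(x)\to\infty$ as $x\to\infty$, and that $F$ is exactly the set of points having no neighbourhood on which $S_F^\alpha$ is constant. $F$-limits and $F$-continuity are limits and continuity along points of $F$. $F^\alpha$-derivative: for $x\in F$, $D_F^\alpha h(x)=F\text{-}\lim_{y\to x}\frac{h(y)-h(x)}{S_F^\alpha(y)-S_F^\alpha(x)}$ if the limit exists, and $D_F^\alpha h(x)=0$ for $x\notin F$. $F^\alpha$-integral: for $h$ bounded on $F\cap[a,b]$, $\int_a^b h\,d_F^\alpha t$ is the common value (if they agree) of the infimum of the upper sums $\sum_i \sup_{F\cap[x_i,x_{i+1}]}h\cdot(S_F^\alpha(x_{i+1})-S_F^\alpha(x_i))$ and the supremum of the corresponding lower sums with $\inf$ (terms with $F\cap[x_i,x_{i+1}]=\emptyset$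 are $0$); integrals of unbounded functions are improper. Caputo fractal derivative of order $\beta\in(0,1)$: $${}^{C}_0\mathcal D^\beta p(S_F^\alpha(t))=\frac{1}{\Gamma(1-\beta)}\int_0^t\bigl(S_F^\alpha(t)-S_F^\alpha(\tau)\bigr)^{-\beta}D_F^\alpha p(S_F^\alpha(\tau))\,d_F^\alpha\tau .$$ A solution is a continuous function $p:[0,\infty)\to\mathbb R$ such that $t\mapsto p(S_F^\alpha(t))$ is $F^\alpha$-differentiable with $F$-continuous derivative at the points of $F$ where $S_F^\alpha(t)>0$, the integral defining ${}^{C}_0\mathcal D^\beta p$ converges absolutely, and the equation holds for all $t$ with $S_F^\alpha(t)>0$; "its solution is" means that the displayed function is the unique solution with the given value $p(0)$. *)

theory Defs
  imports "HOL-Analysis.Analysis"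
begin

subsection \<open>Mass function and integral staircase function\<close>

definition subdivision :: "real \<Rightarrow> real \<Rightarrow> nat \<Rightarrow> (nat \<Rightarrow> real) \<Rightarrow> bool" where
  "subdivision a b n x \<longleftrightarrow> x 0 = a \<and> x n = b \<and> (\<forall>i<n. x i < x (Suc i))"

definition flag :: "real set \<Rightarrow> real set \<Rightarrow> real" where
  "flag F I = (if F \<inter> I \<noteq> {} then 1 else 0)"

definition sigma_sum :: "real \<Rightarrow> real set \<Rightarrow> nat \<Rightarrow> (nat \<Rightarrow> real) \<Rightarrow> real" where
  "sigma_sum \<alpha> F n x =
    (\<Sum>i<n. (x (Suc i) - x i) powr \<alpha> / Gamma (\<alpha> + 1) * flag F {x i..x (Suc i)})"

text \<open>The values lie in \<^typ>\<open>ennreal\<close>, since the mass may be infinite.\<close>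

definition coarse_mass :: "real \<Rightarrow> real set \<Rightarrow> real \<Rightarrow> real \<Rightarrow> real \<Rightarrow> ennreal" where
  "coarse_mass \<alpha> F \<delta> a b =
    (INF (n, x) \<in> {(n, x). subdivision a b n x \<and> (\<forall>i<n. x (Suc i) - x i \<le> \<delta>)}.
       ennreal (sigma_sum \<alpha> F n x))"

definition mass :: "real \<Rightarrow> real set \<Rightarrow> real \<Rightarrow> real \<Rightarrow> ennreal" where
  "mass \<alpha> F a b = Lim (at_right 0) (\<lambda>\<delta>. coarse_mass \<alpha> F \<delta> a b)"

definition staircase :: "real \<Rightarrow> real set \<Rightarrow> real \<Rightarrow> real" where
  "staircase \<alpha> F x = enn2real (mass \<alpha> F 0 x)"

text \<open>The staircase function lives on the half-line, so neighbourhoods are relative to it.\<close>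

definition points_of_change :: "(real \<Rightarrow> real) \<Rightarrow> real set" where
  "points_of_change S =
    {x. 0 \<le> x \<and> \<not> (\<exists>U. open U \<and> x \<in> U \<and> S constant_on (U \<inter> {0..}))}"

definition admissible_fractal :: "real \<Rightarrow> real set \<Rightarrow> bool" where
  "admissible_fractal \<alpha> F \<longleftrightarrow>
     closed F \<and> F \<subseteq> {0..} \<and>
     (\<forall>x\<ge>0. mass \<alpha> F 0 x < \<infinity>) \<and>
     filterlim (staircase \<alpha> F) at_top at_top \<and>
     F = points_of_change (staircase \<alpha> F)"


subsection \<open>Derivative\<close>

definition F_quotient :: "real \<Rightarrow> real set \<Rightarrow> (real \<Rightarrow> real) \<Rightarrow> real \<Rightarrow> real \<Rightarrow> real" where
  "F_quotient \<alpha> F h x y = (h y - h x) / (staircase \<alpha> F y - staircase \<alpha> F x)"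

definition F_differentiable :: "real \<Rightarrow> real set \<Rightarrow> (real \<Rightarrow> real) \<Rightarrow> real \<Rightarrow> bool" where
  "F_differentiable \<alpha> F h x \<longleftrightarrow> (\<exists>D. (F_quotient \<alpha> F h x \<longlongrightarrow> D) (at x within F))"

definition F_deriv :: "real \<Rightarrow> real set \<Rightarrow> (real \<Rightarrow> real) \<Rightarrow> real \<Rightarrow> real" where
  "F_deriv \<alpha> F h x = (if x \<in> F then Lim (at x within F) (F_quotient \<alpha> F h x) else 0)"


subsection \<open>Integral\<close>

definition upper_sum ::
  "real \<Rightarrow> real set \<Rightarrow> (real \<Rightarrow> real) \<Rightarrow> nat \<Rightarrow> (nat \<Rightarrow> real) \<Rightarrow> real" where
  "upper_sum \<alpha> F h n x =
    (\<Sum>i<n. (if F \<inter> {x i..x (Suc i)} = {} then 0 else SUP y \<in> F \<inter> {x i..x (Suc i)}. h y)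
       * (staircase \<alpha> F (x (Suc i)) - staircase \<alpha> F (x i)))"

definition lower_sum ::
  "real \<Rightarrow> real set \<Rightarrow> (real \<Rightarrow> real) \<Rightarrow> nat \<Rightarrow> (nat \<Rightarrow> real) \<Rightarrow> real" where
  "lower_sum \<alpha> F h n x =
    (\<Sum>i<n. (if F \<inter> {x i..x (Suc i)} = {} then 0 else INF y \<in> F \<inter> {x i..x (Suc i)}. h y)
       * (staircase \<alpha> F (x (Suc i)) - staircase \<alpha> F (x i)))"

definition has_proper_F_integral ::
  "real \<Rightarrow> real set \<Rightarrow> (real \<Rightarrow> real) \<Rightarrow> real \<Rightarrow> real \<Rightarrow> real \<Rightarrow> bool" where
  "has_proper_F_integral \<alpha> F h a b I \<longleftrightarrow>
     a \<le> b \<and> bounded (h ` (F \<inter> {a..b})) \<and>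
     (INF (n, x) \<in> {(n, x). subdivision a b n x}. upper_sum \<alpha> F h n x) = I \<and>
     (SUP (n, x) \<in> {(n, x). subdivision a b n x}. lower_sum \<alpha> F h n x) = I"

text \<open>
  Improper integrals allow finitely many singular points \<open>x\<^sub>0 < \<dots> < x\<^sub>n\<close>: on each piece
  \<open>(x\<^sub>i, x\<^sub>i\<^sub>+\<^sub>1)\<close> both end points are approached independently. Interior singular points are
  needed even for the Caputo kernel: it blows up at the first point \<open>\<tau>\<close> where the staircase
  reaches its value at \<open>t\<close>, and \<open>\<tau> < t\<close> if \<open>t\<close> lies in a gap of the fractal.
\<close>

definition has_improper_F_integral ::
  "real \<Rightarrow> real set \<Rightarrow> (real \<Rightarrow> real) \<Rightarrow> real \<Rightarrow> real \<Rightarrow> real \<Rightarrow> bool" where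
  "has_improper_F_integral \<alpha> F h a b I \<longleftrightarrow>
     (\<exists>n x J. subdivision a b n x \<and> I = (\<Sum>i<n. J i) \<and>
       (\<forall>i<n. \<exists>\<Phi>.
          (\<forall>c d. x i < c \<longrightarrow> c < d \<longrightarrow> d < x (Suc i) \<longrightarrow>
             has_proper_F_integral \<alpha> F h c d (\<Phi> (c, d))) \<and>
          (\<Phi> \<longlongrightarrow> J i) (at_right (x i) \<times>\<^sub>F at_left (x (Suc i)))))"

definition has_F_integral ::
  "real \<Rightarrow> real set \<Rightarrow> (real \<Rightarrow> real) \<Rightarrow> real \<Rightarrow> real \<Rightarrow> real \<Rightarrow> bool" where
  "has_F_integral \<alpha> F h a b I \<longleftrightarrow>
     has_proper_F_integral \<alpha> F h a b I \<or> has_improper_F_integral \<alpha> F h a b I"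

definition F_integral :: "real \<Rightarrow> real set \<Rightarrow> (real \<Rightarrow> real) \<Rightarrow> real \<Rightarrow> real \<Rightarrow> real" where
  "F_integral \<alpha> F h a b = (THE I. has_F_integral \<alpha> F h a b I)"

definition absolutely_F_integrable ::
  "real \<Rightarrow> real set \<Rightarrow> (real \<Rightarrow> real) \<Rightarrow> real \<Rightarrow> real \<Rightarrow> bool" where
  "absolutely_F_integrable \<alpha> F h a b \<longleftrightarrow>
     (\<exists>I. has_F_integral \<alpha> F h a b I) \<and> (\<exists>I. has_F_integral \<alpha> F (\<lambda>y. \<bar>h y\<bar>) a b I)"


subsection \<open>Caputo fractal derivative and the price adjustment equation\<close>

definition caputo_integrand ::
  "real \<Rightarrow> real set \<Rightarrow> real \<Rightarrow> (real \<Rightarrow> real) \<Rightarrow> real \<Rightarrow> real \<Rightarrow> real" where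
  "caputo_integrand \<alpha> F \<beta> p t \<tau> =
     (staircase \<alpha> F t - staircase \<alpha> F \<tau>) powr (- \<beta>)
       * F_deriv \<alpha> F (\<lambda>u. p (staircase \<alpha> F u)) \<tau>"

definition caputo_deriv ::
  "real \<Rightarrow> real set \<Rightarrow> real \<Rightarrow> (real \<Rightarrow> real) \<Rightarrow> real \<Rightarrow> real" where
  "caputo_deriv \<alpha> F \<beta> p t =
     1 / Gamma (1 - \<beta>) * F_integral \<alpha> F (caputo_integrand \<alpha> F \<beta> p t) 0 t"

definition price_adjustment_solution ::
  "real \<Rightarrow> real set \<Rightarrow> real \<Rightarrow> real \<Rightarrow> real \<Rightarrow> real \<Rightarrow> real \<Rightarrow> real \<Rightarrow> real \<Rightarrow> (real \<Rightarrow> real) \<Rightarrow> bool"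
where
  "price_adjustment_solution \<alpha> F \<beta> d0 d1 d2 s0 s1 s2 p \<longleftrightarrow>
     continuous_on {0..} p \<and>
     (\<forall>t\<in>F. staircase \<alpha> F t > 0 \<longrightarrow>
        F_differentiable \<alpha> F (\<lambda>u. p (staircase \<alpha> F u)) t \<and>
        continuous (at t within F) (F_deriv \<alpha> F (\<lambda>u. p (staircase \<alpha> F u)))) \<and>
     (\<forall>t\<ge>0. staircase \<alpha> F t > 0 \<longrightarrow>
        absolutely_F_integrable \<alpha> F (caputo_integrand \<alpha> F \<beta> p t) 0 t \<and>
        caputo_deriv \<alpha> F \<beta> p t - (d1 + s1) / (d2 + s2) * p (staircase \<alpha> F t)
          = - ((d0 + s0) / (d2 + s2)))"

definition mittag_leffler :: "real \<Rightarrow> real \<Rightarrow> real" where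
  "mittag_leffler \<beta> x = (\<Sum>j. x ^ j / Gamma (\<beta> * real j + 1))"

end

theory Submission
  imports Defs "HOL-Real_Asymp.Real_Asymp"
begin

text \<open>
  Let \<open>b s\<close> be the largest point at which the staircase \<open>S\<close> takes the value \<open>s\<close>. Every subinterval
  of a subdivision on which \<open>S\<close> grows by more than zero contains \<open>b s\<close> for the values \<open>s\<close> it covers, so
  \<open>F\<close>-sums of \<open>h\<close> are integrals of step functions enclosing \<open>h \<circ> b\<close>, and the \<open>F\<close>-integral of \<open>h\<close> becomes
  an ordinary integral of \<open>h \<circ> b\<close> in the variable \<open>s\<close>. The fractal Caputo equation thus turns into the
  classical one on the half-line.

  A solution \<open>p\<close> may have kinks at the values \<open>s\<close> taken on a gap of \<open>F\<close>, where the \<open>F\<close>-derivative only sees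
  one-sided difference quotients. There are countably many gaps, and a continuous function whose
  derivative vanishes off a countable set is constant, so \<open>p\<close> is still the integral of its derivative.

  Uniqueness: convolving the equation for the difference \<open>u\<close> of two solutions with \<open>r\<^sup>\<beta>\<^sup>-\<^sup>1\<close> inverts the
  fractional integral (Abel) and gives \<open>u r = K \<integral>\<^sub>0\<^sup>r (r - s)\<^sup>\<beta>\<^sup>-\<^sup>1 u s ds\<close>, which forces \<open>u = 0\<close> on successive
  intervals of a fixed length. Existence: the Mittag-Leffler series is integrated against the
  kernel term by term with Euler's Beta integral.
\<close>

subsection \<open>Subdivisions and additivity of the mass\<close>

text \<open>The last point of a level set is the inverse to use because S grows strictly to its
  right, so it always lies in \<open>F\<close>; the first point of level 0 need not. Kinks arise
  because at the two ends of a gap the points of \<open>F\<close> approach the common value from one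
  side each; both one-sided derivatives exist and may differ. A second obstacle is the improper
  integral: its pieces may converge only conditionally, and \<open>F_integral\<close> is meaningful
  only if its value is unique. The absolute convergence demanded of solutions settles this: the
  integral of the absolute value yields an integrable majorant, under which every choice of singular
  points gives the same ordinary integral. The derivative of a solution may be unbounded near 0. Its
  integrability is recovered from the Caputo integrals themselves, since multiplying by the bounded
  function \<open>(r - t) powr \<beta>\<close> removes the kernel. Continuity of the staircase is
  not part of \<open>admissible_fractal\<close>; it rests on additivity of the mass, where cutting a
  subdivision at mesh \<delta> costs at most one extra cell, of order
  \<open>\<delta> powr \<alpha>\<close>.\<close>

lemma subdivision_0: "subdivision a b 0 x \<longleftrightarrow> x 0 = a \<and> a = b"
  by (auto simp: subdivision_def)

lemma subdivision_Suc:
  "subdivision a b (Suc n) x \<longleftrightarrow> subdivision a (x n) n x \<and> x n < b \<and> x (Suc n) = b"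
  by (auto simp: subdivision_def less_Suc_eq)

lemma subdivision_cong:
  assumes "subdivision a b n x" "\<And>i. i \<le> n \<Longrightarrow> x i = y i"
  shows "subdivision a b n y"
  using assms by (auto simp: subdivision_def)

lemma subdivision_imp_le: "subdivision a b n x \<Longrightarrow> a \<le> b"
proof (induction n arbitrary: b)
  case (Suc n)
  then have "a \<le> x n" "x n < b" by (auto simp: subdivision_Suc)
  then show ?case by simp
qed (simp add: subdivision_0)

lemma subdivision_mono:
  assumes "subdivision a b n x" "i \<le> j" "j \<le> n"
  shows "x i \<le> x j"
  using assms(2,3)
proof (induction j rule: dec_induct)
  case (step j)
  then have "x j < x (Suc j)" using assms(1) by (auto simp: subdivision_def)
  with step show ?case by simp
qed simp

lemma subdivision_bounds:
  assumes "subdivision a b n x" "i \<le> n"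
  shows "x i \<in> {a..b}"
  using subdivision_mono[OF assms(1), of 0 i] subdivision_mono[OF assms(1), of i n] assms
  by (auto simp: subdivision_def)

lemma subdivision_snoc:
  assumes "subdivision a b n x" "b < c"
  shows "subdivision a c (Suc n) (x(Suc n := c))"
proof -
  have "subdivision a b n (x(Suc n := c))" by (rule subdivision_cong[OF assms(1)]) auto
  moreover have "x n = b" using assms by (simp add: subdivision_def)
  ultimately show ?thesis using assms by (simp add: subdivision_Suc)
qed

lemma subdivision_1: "a < b \<Longrightarrow> subdivision a b 1 (\<lambda>i. if i = 0 then a else b)"
  by (simp add: subdivision_def)

section \<open>Subdivisions of bounded mesh: cutting and joining\<close>

definition mesh_le :: "real \<Rightarrow> nat \<Rightarrow> (nat \<Rightarrow> real) \<Rightarrow> bool" where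
  "mesh_le \<delta> n x \<longleftrightarrow> (\<forall>i<n. x (Suc i) - x i \<le> \<delta>)"

definition cost :: "real \<Rightarrow> real set \<Rightarrow> real \<Rightarrow> real \<Rightarrow> real" where
  "cost \<alpha> F u v = (v - u) powr \<alpha> / Gamma (\<alpha> + 1) * flag F {u..v}"

lemma mesh_le_Suc: "mesh_le \<delta> (Suc n) x \<longleftrightarrow> mesh_le \<delta> n x \<and> x (Suc n) - x n \<le> \<delta>"
  by (auto simp: mesh_le_def less_Suc_eq)

lemma sigma_sum_Suc: "sigma_sum \<alpha> F (Suc n) x = sigma_sum \<alpha> F n x + cost \<alpha> F (x n) (x (Suc n))"
  by (simp add: sigma_sum_def cost_def)

lemma upd_beyond:
  "mesh_le \<delta> n (x(Suc n := c)) = mesh_le \<delta> n x"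
  "sigma_sum \<alpha> F n (x(Suc n := c)) = sigma_sum \<alpha> F n x"
  by (auto simp: mesh_le_def sigma_sum_def intro!: sum.cong)

lemma cost_nonneg: "0 < \<alpha> \<Longrightarrow> 0 \<le> cost \<alpha> F u v"
  by (auto simp: cost_def flag_def intro!: divide_nonneg_pos Gamma_real_pos)

lemma cost_mono:
  assumes "0 < \<alpha>" "u \<le> u'" "u' \<le> v'" "v' \<le> v"
  shows "cost \<alpha> F u' v' \<le> cost \<alpha> F u v"
  unfolding cost_def
proof (rule mult_mono)
  show "(v' - u') powr \<alpha> / Gamma (\<alpha> + 1) \<le> (v - u) powr \<alpha> / Gamma (\<alpha> + 1)"
    using assms by (intro divide_right_mono powr_mono2) (auto intro!: less_imp_le Gamma_real_pos)
  show "flag F {u'..v'} \<le> flag F {u..v}"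
    using assms by (fastforce simp: flag_def)
qed (use assms in \<open>auto simp: flag_def intro!: divide_nonneg_pos Gamma_real_pos\<close>)

lemma cost_le:
  assumes "0 < \<alpha>" "u \<le> v" "v - u \<le> \<delta>"
  shows "cost \<alpha> F u v \<le> \<delta> powr \<alpha> / Gamma (\<alpha> + 1)"
proof -
  have "cost \<alpha> F u v \<le> (v - u) powr \<alpha> / Gamma (\<alpha> + 1) * 1"
    unfolding cost_def using assms
    by (intro mult_left_mono) (auto simp: flag_def intro!: divide_nonneg_pos Gamma_real_pos)
  also have "\<dots> \<le> \<delta> powr \<alpha> / Gamma (\<alpha> + 1)"
    using assms by (auto intro!: divide_right_mono powr_mono2 less_imp_le[OF Gamma_real_pos])
  finally show ?thesis .
qed

lemma sigma_sum_nonneg: "0 < \<alpha> \<Longrightarrow> 0 \<le> sigma_sum \<alpha> F n x"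
  using cost_nonneg unfolding sigma_sum_def cost_def by (intro sum_nonneg) auto

text \<open>Only the cell containing b is split. Its left half costs no more than the whole cell by
  monotonicity, and its right half, being no longer than \<delta>, accounts for the error term,
  which vanishes as \<delta> tends to 0.\<close>

lemma subdivision_cut:
  assumes "0 < \<alpha>" "0 < \<delta>" "subdivision a c n x" "mesh_le \<delta> n x" "a \<le> b" "b \<le> c"
  shows "\<exists>n1 x1 n2 x2. subdivision a b n1 x1 \<and> mesh_le \<delta> n1 x1 \<and>
           subdivision b c n2 x2 \<and> mesh_le \<delta> n2 x2 \<and>
           sigma_sum \<alpha> F n1 x1 + sigma_sum \<alpha> F n2 x2 \<le> sigma_sum \<alpha> F n x + \<delta> powr \<alpha> / Gamma (\<alpha> + 1)"
  using assms(3-6)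
proof (induction n arbitrary: c)
  case 0
  then have *: "a = c" "b = a" by (auto simp: subdivision_0)
  show ?case
    by (rule exI[of _ 0], rule exI[of _ "\<lambda>_. a"], rule exI[of _ 0], rule exI[of _ "\<lambda>_. a"])
       (use * assms(1) in \<open>auto simp: subdivision_0 mesh_le_def sigma_sum_def
          intro!: divide_nonneg_pos Gamma_real_pos\<close>)
next
  case (Suc n)
  have sub: "subdivision a (x n) n x" and lt: "x n < c" and xS: "x (Suc n) = c"
    using Suc.prems by (auto simp: subdivision_Suc)
  have mesh: "mesh_le \<delta> n x" "c - x n \<le> \<delta>" using Suc.prems xS by (auto simp: mesh_le_Suc)
  show ?case
  proof (cases "b \<le> x n")
    case True
    from Suc.IH[OF sub mesh(1) \<open>a \<le> b\<close> True] obtain n1 x1 n2 x2 where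
      1: "subdivision a b n1 x1" "mesh_le \<delta> n1 x1" "subdivision b (x n) n2 x2" "mesh_le \<delta> n2 x2"
        "sigma_sum \<alpha> F n1 x1 + sigma_sum \<alpha> F n2 x2 \<le> sigma_sum \<alpha> F n x + \<delta> powr \<alpha> / Gamma (\<alpha> + 1)"
      by auto
    have last: "x2 n2 = x n" using 1(3) by (simp add: subdivision_def)
    define y where "y = x2(Suc n2 := c)"
    have "subdivision b c (Suc n2) y" "mesh_le \<delta> (Suc n2) y"
      "sigma_sum \<alpha> F (Suc n2) y = sigma_sum \<alpha> F n2 x2 + cost \<alpha> F (x n) c"
      using 1 lt mesh last
      by (auto simp: y_def mesh_le_Suc sigma_sum_Suc upd_beyond intro!: subdivision_snoc)
    then show ?thesis
      using 1 xS
      by (intro exI[of _ n1] exI[of _ x1] exI[of _ "Suc n2"] exI[of _ y]) (auto simp: sigma_sum_Suc)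
  next
    case False
    define y where "y = x(Suc n := b)"
    have y: "subdivision a b (Suc n) y" "mesh_le \<delta> (Suc n) y"
      "sigma_sum \<alpha> F (Suc n) y \<le> sigma_sum \<alpha> F (Suc n) x"
      using False sub mesh \<open>b \<le> c\<close> xS cost_mono[OF assms(1), of "x n" "x n" b c]
      by (auto simp: y_def mesh_le_Suc sigma_sum_Suc upd_beyond intro!: subdivision_snoc)
    show ?thesis
    proof (cases "b = c")
      case True
      show ?thesis
        by (rule exI[of _ "Suc n"], rule exI[of _ y], rule exI[of _ 0], rule exI[of _ "\<lambda>_. b"])
         (use y True assms(1) in \<open>auto simp: subdivision_0 mesh_le_def sigma_sum_def
          intro!: add_increasing2 divide_nonneg_pos Gamma_real_pos\<close>)
    next
      case ne: False
      define z where "z = (\<lambda>i::nat. if i = 0 then b else c)"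
      have "sigma_sum \<alpha> F 1 z = cost \<alpha> F b c" by (simp add: sigma_sum_def cost_def z_def)
      also have "\<dots> \<le> \<delta> powr \<alpha> / Gamma (\<alpha> + 1)"
        using False \<open>b \<le> c\<close> mesh assms(1) by (intro cost_le) auto
      finally have "sigma_sum \<alpha> F 1 z \<le> \<delta> powr \<alpha> / Gamma (\<alpha> + 1)" .
      moreover have "subdivision b c 1 z"
        unfolding z_def using ne \<open>b \<le> c\<close> by (intro subdivision_1) auto
      moreover have "mesh_le \<delta> 1 z" using False mesh by (auto simp: mesh_le_def z_def)
      ultimately show ?thesis
        using y by (intro exI[of _ "Suc n"] exI[of _ y] exI[of _ 1] exI[of _ z]) auto
    qed
  qed
qed

lemma subdivision_concat:
  assumes "subdivision a b n1 x1" "mesh_le \<delta> n1 x1" "subdivision b c n2 x2" "mesh_le \<delta> n2 x2"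
  shows "\<exists>n x. subdivision a c n x \<and> mesh_le \<delta> n x \<and>
           sigma_sum \<alpha> F n x = sigma_sum \<alpha> F n1 x1 + sigma_sum \<alpha> F n2 x2"
  using assms(3,4)
proof (induction n2 arbitrary: c)
  case 0
  then show ?case using assms by (auto simp: subdivision_0 sigma_sum_def)
next
  case (Suc n2)
  have sub: "subdivision b (x2 n2) n2 x2" "mesh_le \<delta> n2 x2" using Suc.prems
    by (auto simp: subdivision_Suc mesh_le_Suc)
  from Suc.IH[OF this] obtain n x where
    1: "subdivision a (x2 n2) n x" "mesh_le \<delta> n x"
      "sigma_sum \<alpha> F n x = sigma_sum \<alpha> F n1 x1 + sigma_sum \<alpha> F n2 x2" by auto
  have "x n = x2 n2" using 1 by (simp add: subdivision_def)
  define y where "y = x(Suc n := c)"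
  have c: "x2 n2 < c" "x2 (Suc n2) = c" "c - x2 n2 \<le> \<delta>"
    using Suc.prems by (auto simp: subdivision_Suc[of b] mesh_le_Suc)
  have "subdivision a c (Suc n) y" "mesh_le \<delta> (Suc n) y"
    "sigma_sum \<alpha> F (Suc n) y = sigma_sum \<alpha> F n x + cost \<alpha> F (x2 n2) c"
    using 1 c \<open>x n = x2 n2\<close>
    by (auto simp: y_def mesh_le_Suc sigma_sum_Suc upd_beyond intro!: subdivision_snoc)
  with 1 c show ?case
    by (intro exI[of _ "Suc n"] exI[of _ y]) (auto simp: sigma_sum_Suc)
qed

section \<open>Coarse mass, its limit, and additivity\<close>

lemma coarse_mass_eq:
  "coarse_mass \<alpha> F \<delta> a b =
    (INF (n, x) \<in> {(n, x). subdivision a b n x \<and> mesh_le \<delta> n x}. ennreal (sigma_sum \<alpha> F n x))"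
  by (simp add: coarse_mass_def mesh_le_def)

lemma coarse_mass_lower:
  "subdivision a b n x \<Longrightarrow> mesh_le \<delta> n x \<Longrightarrow> coarse_mass \<alpha> F \<delta> a b \<le> ennreal (sigma_sum \<alpha> F n x)"
  unfolding coarse_mass_eq by (rule INF_lower2[of "(n, x)"]) auto

lemma coarse_mass_greatest:
  assumes "\<And>n x. subdivision a b n x \<Longrightarrow> mesh_le \<delta> n x \<Longrightarrow> c \<le> ennreal (sigma_sum \<alpha> F n x)"
  shows "c \<le> coarse_mass \<alpha> F \<delta> a b"
  unfolding coarse_mass_eq using assms by (auto intro!: INF_greatest)

lemma coarse_mass_antimono: "\<delta> \<le> \<epsilon> \<Longrightarrow> coarse_mass \<alpha> F \<epsilon> a b \<le> coarse_mass \<alpha> F \<delta> a b"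
  by (rule coarse_mass_greatest, rule coarse_mass_lower) (auto simp: mesh_le_def)

text \<open>A smaller mesh leaves fewer subdivisions, so the coarse mass increases as \<delta>
  decreases. Hence the limit selected by \<open>Lim\<close> exists and is a supremum.\<close>

lemma mass_eq_SUP: "mass \<alpha> F a b = (SUP \<delta>\<in>{0<..}. coarse_mass \<alpha> F \<delta> a b)"
  and tendsto_coarse_mass: "((\<lambda>\<delta>. coarse_mass \<alpha> F \<delta> a b) \<longlongrightarrow> mass \<alpha> F a b) (at_right 0)"
proof -
  have lim: "((\<lambda>\<delta>. coarse_mass \<alpha> F \<delta> a b) \<longlongrightarrow> (SUP \<delta>\<in>{0<..}. coarse_mass \<alpha> F \<delta> a b)) (at_right 0)"
  proof (rule order_tendstoI)
    fix y assume "y < (SUP \<delta>\<in>{0<..}. coarse_mass \<alpha> F \<delta> a b)"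
    then obtain d where d: "d > 0" "y < coarse_mass \<alpha> F d a b" by (auto simp: less_SUP_iff)
    have "\<forall>\<^sub>F \<delta> in at_right 0. \<delta> < d"
      using d(1) eventually_at_right_field by blast
    then show "\<forall>\<^sub>F \<delta> in at_right 0. y < coarse_mass \<alpha> F \<delta> a b"
    proof eventually_elim
      case (elim \<delta>)
      show ?case
        by (rule less_le_trans[OF d(2) coarse_mass_antimono]) (use elim in simp)
    qed
  next
    fix y assume "(SUP \<delta>\<in>{0<..}. coarse_mass \<alpha> F \<delta> a b) < y"
    then show "\<forall>\<^sub>F \<delta> in at_right 0. coarse_mass \<alpha> F \<delta> a b < y"
      by (intro eventually_mono[OF eventually_at_right_less[of "0::real"]])
         (rule le_less_trans[OF SUP_upper], auto)
  qed
  show "mass \<alpha> F a b = (SUP \<delta>\<in>{0<..}. coarse_mass \<alpha> F \<delta> a b)"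
    unfolding mass_def by (rule tendsto_Lim[OF _ lim]) simp
  with lim show "((\<lambda>\<delta>. coarse_mass \<alpha> F \<delta> a b) \<longlongrightarrow> mass \<alpha> F a b) (at_right 0)" by simp
qed

lemma coarse_mass_le_mass: "0 < \<delta> \<Longrightarrow> coarse_mass \<alpha> F \<delta> a b \<le> mass \<alpha> F a b"
  unfolding mass_eq_SUP by (rule SUP_upper) simp

lemma coarse_mass_subadd:
  assumes "0 < \<alpha>"
  shows "coarse_mass \<alpha> F \<delta> a c \<le> coarse_mass \<alpha> F \<delta> a b + coarse_mass \<alpha> F \<delta> b c"
proof (rule ennreal_le_epsilon)
  fix e :: real assume fin: "coarse_mass \<alpha> F \<delta> a b + coarse_mass \<alpha> F \<delta> b c < top" and e: "e > 0"
  have "\<exists>n x. subdivision u v n x \<and> mesh_le \<delta> n x \<and>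
      ennreal (sigma_sum \<alpha> F n x) < coarse_mass \<alpha> F \<delta> u v + ennreal (e/2)"
    if "coarse_mass \<alpha> F \<delta> u v < top" for u v
  proof -
    have "coarse_mass \<alpha> F \<delta> u v < coarse_mass \<alpha> F \<delta> u v + ennreal (e/2)"
      using that e by (simp add: ennreal_add_left_cancel_less[of _ 0, simplified] less_top)
    then show ?thesis by (subst (asm) (1) coarse_mass_eq) (auto simp: INF_less_iff)
  qed
  from this[of a b] this[of b c] fin obtain n1 x1 n2 x2 where
    1: "subdivision a b n1 x1" "mesh_le \<delta> n1 x1" "subdivision b c n2 x2" "mesh_le \<delta> n2 x2"
      "ennreal (sigma_sum \<alpha> F n1 x1) < coarse_mass \<alpha> F \<delta> a b + ennreal (e/2)"
      "ennreal (sigma_sum \<alpha> F n2 x2) < coarse_mass \<alpha> F \<delta> b c + ennreal (e/2)"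
    by (auto simp: less_top)
  from subdivision_concat[OF 1(1-4)] obtain n x where
    2: "subdivision a c n x" "mesh_le \<delta> n x"
       "sigma_sum \<alpha> F n x = sigma_sum \<alpha> F n1 x1 + sigma_sum \<alpha> F n2 x2" by blast
  have "coarse_mass \<alpha> F \<delta> a c \<le> ennreal (sigma_sum \<alpha> F n x)" by (rule coarse_mass_lower[OF 2(1,2)])
  also have "\<dots> = ennreal (sigma_sum \<alpha> F n1 x1) + ennreal (sigma_sum \<alpha> F n2 x2)"
    using 2(3) sigma_sum_nonneg[OF assms] by simp
  also have "\<dots> \<le> (coarse_mass \<alpha> F \<delta> a b + ennreal (e/2)) + (coarse_mass \<alpha> F \<delta> b c + ennreal (e/2))"
    using 1 by (intro add_mono) auto
  also have "\<dots> = coarse_mass \<alpha> F \<delta> a b + coarse_mass \<alpha> F \<delta> b c + (ennreal (e/2) + ennreal (e/2))"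
    by (simp add: ac_simps)
  also have "ennreal (e/2) + ennreal (e/2) = ennreal e"
    using e by (simp flip: ennreal_plus)
  finally show "coarse_mass \<alpha> F \<delta> a c \<le> coarse_mass \<alpha> F \<delta> a b + coarse_mass \<alpha> F \<delta> b c + ennreal e" .
qed

text \<open>Cutting a nearly optimal subdivision of [a, c] at b creates one surplus cell, which is
  the error term; joining subdivisions, by contrast, is free.\<close>

lemma coarse_mass_superadd:
  assumes "0 < \<alpha>" "0 < \<delta>" "a \<le> b" "b \<le> c"
  shows "coarse_mass \<alpha> F \<delta> a b + coarse_mass \<alpha> F \<delta> b c
    \<le> coarse_mass \<alpha> F \<delta> a c + ennreal (\<delta> powr \<alpha> / Gamma (\<alpha> + 1))"
proof (rule ennreal_le_epsilon)
  fix e :: real assume fin: "coarse_mass \<alpha> F \<delta> a c + ennreal (\<delta> powr \<alpha> / Gamma (\<alpha> + 1)) < top"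
    and e: "e > 0"
  have "coarse_mass \<alpha> F \<delta> a c < coarse_mass \<alpha> F \<delta> a c + ennreal e"
    using fin e by (simp add: ennreal_add_left_cancel_less[of _ 0, simplified] less_top)
  then obtain n x where 1: "subdivision a c n x" "mesh_le \<delta> n x"
     "ennreal (sigma_sum \<alpha> F n x) < coarse_mass \<alpha> F \<delta> a c + ennreal e"
    by (subst (asm) (1) coarse_mass_eq) (auto simp: INF_less_iff)
  from subdivision_cut[OF assms(1,2) 1(1,2) assms(3,4), where F = F] obtain n1 x1 n2 x2 where
    2: "subdivision a b n1 x1" "mesh_le \<delta> n1 x1" "subdivision b c n2 x2" "mesh_le \<delta> n2 x2"
      "sigma_sum \<alpha> F n1 x1 + sigma_sum \<alpha> F n2 x2 \<le> sigma_sum \<alpha> F n x + \<delta> powr \<alpha> / Gamma (\<alpha> + 1)"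
    by blast
  have G: "0 \<le> \<delta> powr \<alpha> / Gamma (\<alpha> + 1)"
    using assms(1) by (auto intro!: divide_nonneg_pos Gamma_real_pos)
  have "coarse_mass \<alpha> F \<delta> a b + coarse_mass \<alpha> F \<delta> b c
      \<le> ennreal (sigma_sum \<alpha> F n1 x1) + ennreal (sigma_sum \<alpha> F n2 x2)"
    by (intro add_mono coarse_mass_lower 2)
  also have "\<dots> \<le> ennreal (sigma_sum \<alpha> F n x + \<delta> powr \<alpha> / Gamma (\<alpha> + 1))"
    using 2(5) sigma_sum_nonneg[OF assms(1)] by (simp flip: ennreal_plus add: ennreal_leI)
  also have "\<dots> = ennreal (sigma_sum \<alpha> F n x) + ennreal (\<delta> powr \<alpha> / Gamma (\<alpha> + 1))"
    using G sigma_sum_nonneg[OF assms(1)] by simp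
  also have "\<dots> \<le> coarse_mass \<alpha> F \<delta> a c + ennreal e + ennreal (\<delta> powr \<alpha> / Gamma (\<alpha> + 1))"
    using 1(3) by (intro add_right_mono) auto
  finally show "coarse_mass \<alpha> F \<delta> a b + coarse_mass \<alpha> F \<delta> b c
    \<le> coarse_mass \<alpha> F \<delta> a c + ennreal (\<delta> powr \<alpha> / Gamma (\<alpha> + 1)) + ennreal e"
    by (simp add: ac_simps)
qed

lemma coarse_mass_short:
  assumes "0 < \<alpha>" "a \<le> b" "b - a \<le> \<delta>"
  shows "coarse_mass \<alpha> F \<delta> a b \<le> ennreal ((b - a) powr \<alpha> / Gamma (\<alpha> + 1))"
proof (cases "a = b")
  case True
  have "coarse_mass \<alpha> F \<delta> a b \<le> ennreal (sigma_sum \<alpha> F 0 (\<lambda>_. a))"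
    by (rule coarse_mass_lower) (auto simp: subdivision_0 mesh_le_def True)
  also have "\<dots> = 0" by (simp add: sigma_sum_def)
  finally show ?thesis by simp
next
  case False
  define z where "z = (\<lambda>i::nat. if i = 0 then a else b)"
  have "coarse_mass \<alpha> F \<delta> a b \<le> ennreal (sigma_sum \<alpha> F 1 z)"
    using assms False subdivision_1[of a b]
    by (intro coarse_mass_lower) (auto simp: z_def mesh_le_def)
  also have "sigma_sum \<alpha> F 1 z = cost \<alpha> F a b" by (simp add: sigma_sum_def cost_def z_def)
  also have "ennreal (cost \<alpha> F a b) \<le> ennreal ((b - a) powr \<alpha> / Gamma (\<alpha> + 1))"
    using assms by (intro ennreal_leI cost_le) auto
  finally show ?thesis .
qed

lemma tendsto_powr_Gamma_0:
  assumes "0 < \<alpha>"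
  shows "((\<lambda>\<delta>. ennreal (\<delta> powr \<alpha> / Gamma (\<alpha> + 1))) \<longlongrightarrow> 0) (at_right 0)"
proof -
  have "((\<lambda>\<delta>. \<delta> powr \<alpha> / Gamma (\<alpha> + 1)) \<longlongrightarrow> 0 powr \<alpha> / Gamma (\<alpha> + 1)) (at_right 0)"
    using assms Gamma_real_pos[of "\<alpha> + 1"]
    by (intro tendsto_intros tendsto_powr')
       (auto intro!: eventually_mono[OF eventually_at_right_less] simp: less_imp_neq[symmetric])
  then show ?thesis by (auto intro: tendsto_ennrealI[of _ 0, simplified])
qed

text \<open>Both coarse inequalities pass to the limit, where the cost of the surplus cell
  disappears because \<alpha> is positive.\<close>

lemma mass_additive:
  assumes "0 < \<alpha>" "a \<le> b" "b \<le> c"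
  shows "mass \<alpha> F a c = mass \<alpha> F a b + mass \<alpha> F b c"
proof (rule antisym)
  show "mass \<alpha> F a c \<le> mass \<alpha> F a b + mass \<alpha> F b c"
    by (rule tendsto_le[OF _ tendsto_add[OF tendsto_coarse_mass tendsto_coarse_mass] tendsto_coarse_mass])
       (auto intro!: always_eventually coarse_mass_subadd assms)
  have "mass \<alpha> F a b + mass \<alpha> F b c \<le> mass \<alpha> F a c + 0"
    by (rule tendsto_le[OF _ tendsto_add[OF tendsto_coarse_mass tendsto_powr_Gamma_0[OF assms(1)]]
          tendsto_add[OF tendsto_coarse_mass tendsto_coarse_mass]])
       (auto intro!: eventually_mono[OF eventually_at_right_less] coarse_mass_superadd assms)
  then show "mass \<alpha> F a b + mass \<alpha> F b c \<le> mass \<alpha> F a c" by simp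
qed

lemma mass_trivial: "0 < \<alpha> \<Longrightarrow> mass \<alpha> F a a = 0"
  using coarse_mass_short[of \<alpha> a a] unfolding mass_eq_SUP by (auto simp: SUP_eq_const intro!: SUP_eqI)

lemma mass_le_coarse_mass_add:
  assumes "mass \<alpha> F a b < top" "0 < e"
  shows "\<exists>d>0. mass \<alpha> F a b \<le> coarse_mass \<alpha> F d a b + ennreal e"
proof (cases "mass \<alpha> F a b \<le> ennreal e")
  case True
  then show ?thesis by (intro exI[of _ 1]) (auto intro: add_increasing)
next
  case False
  obtain m where m: "mass \<alpha> F a b = ennreal m" "m \<ge> 0"
    using assms by (cases "mass \<alpha> F a b") auto
  with False have "m > e" using assms(2) by (auto simp: not_le ennreal_less_iff)
  then have "ennreal (m - e) < mass \<alpha> F a b"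
    using assms m by (simp add: ennreal_less_iff)
  then obtain d where d: "d > 0" "ennreal (m - e) < coarse_mass \<alpha> F d a b"
    by (subst (asm) mass_eq_SUP) (auto simp: less_SUP_iff)
  have "mass \<alpha> F a b = ennreal (m - e) + ennreal e"
    using m \<open>m > e\<close> assms(2) by (simp flip: ennreal_plus)
  also have "\<dots> \<le> coarse_mass \<alpha> F d a b + ennreal e"
    using d by (intro add_right_mono) auto
  finally show ?thesis using d by blast
qed

text \<open>An interval at an end, shorter than the mesh, costs at most its own length to the power \<open>\<alpha>\<close>; hence
  no mass concentrates at a point.\<close>

lemma mass_small:
  assumes "0 < \<alpha>" "mass \<alpha> F a b < top" "0 < e"
  shows "\<exists>d>0. \<forall>x. a \<le> x \<longrightarrow> x \<le> b \<longrightarrow>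
    (b - x < d \<longrightarrow> mass \<alpha> F x b \<le> ennreal e) \<and> (x - a < d \<longrightarrow> mass \<alpha> F a x \<le> ennreal e)"
proof -
  \<comment> \<open>At mesh \<open>d1\<close> the coarse mass of the whole interval already exhausts
    the mass up to e/2, and a cell shorter than \<open>d2\<close> costs less than e/2. Subtracting
    the finite mass of the remaining part then bounds the mass of a short end interval.\<close>
  obtain d1 where d1: "d1 > 0" "mass \<alpha> F a b \<le> coarse_mass \<alpha> F d1 a b + ennreal (e/2)"
    using mass_le_coarse_mass_add[OF assms(2), of "e/2"] assms(3) by auto
  have "\<forall>\<^sub>F \<delta> in at_right 0. ennreal (\<delta> powr \<alpha> / Gamma (\<alpha> + 1)) < ennreal (e/2)"
    using assms(3) by (intro order_tendstoD[OF tendsto_powr_Gamma_0[OF assms(1)]]) auto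
  then obtain d2 where d2: "d2 > 0"
    "\<And>\<delta>. 0 < \<delta> \<Longrightarrow> \<delta> < d2 \<Longrightarrow> ennreal (\<delta> powr \<alpha> / Gamma (\<alpha> + 1)) < ennreal (e/2)"
    by (auto simp: eventually_at_right_field)
  have short: "coarse_mass \<alpha> F d1 u v \<le> ennreal (e/2)" if "u \<le> v" "v - u < min d1 d2" for u v
  proof -
    have "coarse_mass \<alpha> F d1 u v \<le> ennreal ((v - u) powr \<alpha> / Gamma (\<alpha> + 1))"
      using that by (intro coarse_mass_short assms) auto
    also have "\<dots> \<le> ennreal (e/2)"
      using that d2(2)[of "v - u"] by (cases "u = v") auto
    finally show ?thesis .
  qed
  have ee: "ennreal (e/2) + ennreal (e/2) = ennreal e"
    using assms(3) by (simp flip: ennreal_plus)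
  show ?thesis
  proof (intro exI[of _ "min d1 d2"] conjI allI impI)
    fix x assume x: "a \<le> x" "x \<le> b"
    have add: "mass \<alpha> F a b = mass \<alpha> F a x + mass \<alpha> F x b"
      by (rule mass_additive) (use assms x in auto)
    have sub: "coarse_mass \<alpha> F d1 a b \<le> coarse_mass \<alpha> F d1 a x + coarse_mass \<alpha> F d1 x b"
      by (rule coarse_mass_subadd) fact
    have fin: "mass \<alpha> F a x < top" "mass \<alpha> F x b < top"
      using assms(2) add by auto
    { assume "b - x < min d1 d2"
      then have "coarse_mass \<alpha> F d1 a x + coarse_mass \<alpha> F d1 x b \<le> mass \<alpha> F a x + ennreal (e/2)"
        using short[of x b] x d1(1) by (intro add_mono coarse_mass_le_mass) auto
      then have "mass \<alpha> F a b \<le> mass \<alpha> F a x + ennreal (e/2) + ennreal (e/2)"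
        using d1(2) sub by (meson add_right_mono order_trans)
      then have "mass \<alpha> F a x + mass \<alpha> F x b \<le> mass \<alpha> F a x + ennreal e"
        by (simp only: add.assoc ee add)
      then show "mass \<alpha> F x b \<le> ennreal e"
        using fin by (auto simp: ennreal_add_left_cancel_le) }
    { assume "x - a < min d1 d2"
      then have "coarse_mass \<alpha> F d1 a x + coarse_mass \<alpha> F d1 x b \<le> ennreal (e/2) + mass \<alpha> F x b"
        using short[of a x] x d1(1) by (intro add_mono coarse_mass_le_mass) auto
      then have "mass \<alpha> F a b \<le> ennreal (e/2) + mass \<alpha> F x b + ennreal (e/2)"
        using d1(2) sub by (meson add_right_mono order_trans)
      then have "mass \<alpha> F x b + mass \<alpha> F a x \<le> mass \<alpha> F x b + (ennreal (e/2) + ennreal (e/2))"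
        using add by (simp only: ac_simps)
      then have "mass \<alpha> F x b + mass \<alpha> F a x \<le> mass \<alpha> F x b + ennreal e"
        by (simp only: ee)
      then show "mass \<alpha> F a x \<le> ennreal e"
        using fin by (auto simp: ennreal_add_left_cancel_le) }
  qed (use d1 d2 in auto)
qed

subsection \<open>The staircase function and its inverses\<close>

locale fractal =
  fixes \<alpha> :: real and F :: "real set"
  assumes alpha_pos: "0 < \<alpha>" and admissible: "admissible_fractal \<alpha> F"
begin

abbreviation S :: "real \<Rightarrow> real" where "S \<equiv> staircase \<alpha> F"

lemma in_F_iff: "x \<in> F \<longleftrightarrow> 0 \<le> x \<and> \<not> (\<exists>U. open U \<and> x \<in> U \<and> S constant_on (U \<inter> {0..}))"
proof -
  have "F = points_of_change S"
    using admissible unfolding admissible_fractal_def by blast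
  then have "x \<in> F \<longleftrightarrow> x \<in> points_of_change S" by (rule arg_cong)
  then show ?thesis by (simp only: points_of_change_def mem_Collect_eq)
qed

lemma F_nonneg: "x \<in> F \<Longrightarrow> 0 \<le> x"
  using admissible unfolding admissible_fractal_def by auto

lemma mass_finite: "0 \<le> x \<Longrightarrow> x \<le> y \<Longrightarrow> mass \<alpha> F x y < top"
  using mass_additive[OF alpha_pos, of 0 x y F] admissible
  unfolding admissible_fractal_def by (auto simp: add_top dest: spec[of _ y])

lemma staircase_diff:
  assumes "0 \<le> x" "x \<le> y"
  shows "S y - S x = enn2real (mass \<alpha> F x y)"
  using mass_additive[OF alpha_pos, of 0 x y F] mass_finite[of 0 x] mass_finite[of x y] assms
  by (auto simp: staircase_def enn2real_plus)

lemma staircase_0 [simp]: "S 0 = 0"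
  using mass_trivial[OF alpha_pos] by (simp add: staircase_def)

lemma staircase_mono: "0 \<le> x \<Longrightarrow> x \<le> y \<Longrightarrow> S x \<le> S y"
  using staircase_diff[of x y] enn2real_nonneg[of "mass \<alpha> F x y"] by linarith

lemma staircase_nonneg: "0 \<le> x \<Longrightarrow> 0 \<le> S x"
  using staircase_mono[of 0 x] by simp

text \<open>Increments of S are masses of intervals. \<open>mass_small\<close> on [0, x] controls
  those ending at x, and on [x, x + 1] those starting there.\<close>

lemma continuous_on_staircase: "continuous_on {0..} S"
  unfolding continuous_on_iff
proof (intro ballI allI impI)
  fix x e :: real assume x: "x \<in> {0..}" and e: "0 < e"
  have "0 < e/2" "mass \<alpha> F 0 x < top" "mass \<alpha> F x (x+1) < top" using x e mass_finite by auto
  from mass_small[OF alpha_pos this(2,1)] mass_small[OF alpha_pos this(3,1)]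
  obtain d1 d2 where d1: "d1 > 0" "\<forall>y. 0 \<le> y \<longrightarrow> y \<le> x \<longrightarrow>
    (x - y < d1 \<longrightarrow> mass \<alpha> F y x \<le> ennreal (e/2)) \<and> (y - 0 < d1 \<longrightarrow> mass \<alpha> F 0 y \<le> ennreal (e/2))"
    and d2: "d2 > 0" "\<forall>y. x \<le> y \<longrightarrow> y \<le> x + 1 \<longrightarrow>
    (x + 1 - y < d2 \<longrightarrow> mass \<alpha> F y (x+1) \<le> ennreal (e/2)) \<and> (y - x < d2 \<longrightarrow> mass \<alpha> F x y \<le> ennreal (e/2))"
    by (elim exE conjE)
  show "\<exists>d>0. \<forall>y\<in>{0..}. dist y x < d \<longrightarrow> dist (S y) (S x) < e"
  proof (intro exI[of _ "min 1 (min d1 d2)"] conjI ballI impI)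
    fix y assume y: "y \<in> {0..}" "dist y x < min 1 (min d1 d2)"
    show "dist (S y) (S x) < e"
    proof (cases "y \<le> x")
      case True
      then have "enn2real (mass \<alpha> F y x) \<le> e/2"
        using d1(2)[rule_format, of y] y e by (intro enn2real_leI) (auto simp: dist_real_def)
      then show ?thesis
        using True staircase_diff[of y x] staircase_mono[of y x] y e by (auto simp: dist_real_def)
    next
      case False
      then have "enn2real (mass \<alpha> F x y) \<le> e/2"
        using d2(2)[rule_format, of y] y e by (intro enn2real_leI) (auto simp: dist_real_def)
      then show ?thesis
        using False staircase_diff[of x y] staircase_mono[of x y] x e by (auto simp: dist_real_def)
    qed
  qed (use d1 d2 in auto)
qed

lemma ex_staircase_gt: "\<exists>y\<ge>0. \<forall>z\<ge>y. s < S z"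
proof -
  have "filterlim S at_top at_top"
    using admissible unfolding admissible_fractal_def by blast
  then have "\<forall>\<^sub>F z in at_top. s < S z" by (simp add: filterlim_at_top_dense)
  then obtain N where "\<And>z. z \<ge> N \<Longrightarrow> s < S z"
    by (meson eventually_at_top_linorder)
  then show ?thesis by (intro exI[of _ "max 0 N"]) auto
qed

lemma closed_level: "closed {x. 0 \<le> x \<and> S x = s}"
proof -
  have "closed ({0..} \<inter> S -` {s})"
    by (intro continuous_closed_preimage continuous_on_staircase) auto
  also have "{0..} \<inter> S -` {s} = {x. 0 \<le> x \<and> S x = s}" by auto
  finally show ?thesis .
qed

lemma ex_level:
  assumes "0 \<le> s"
  shows "\<exists>x\<ge>0. S x = s"
proof -
  obtain y where y: "y \<ge> 0" "s < S y" using ex_staircase_gt[of s] by auto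
  have "\<exists>x\<ge>0. x \<le> y \<and> S x = s"
    using y assms continuous_on_subset[OF continuous_on_staircase, of "{0..y}"]
    by (intro IVT') auto
  then show ?thesis by blast
qed

lemma in_FI:
  assumes "0 \<le> x" "\<And>e. 0 < e \<Longrightarrow> \<exists>y\<ge>0. dist y x < e \<and> S y \<noteq> S x"
  shows "x \<in> F"
proof -
  have "\<not> S constant_on U \<inter> {0..}" if U: "open U" "x \<in> U" for U
  proof -
    obtain e where e: "e > 0" "ball x e \<subseteq> U" using U by (meson open_contains_ball)
    obtain y where "y \<ge> 0" "dist y x < e" "S y \<noteq> S x" using assms(2)[OF e(1)] by blast
    moreover from this e have "y \<in> U" by (auto simp: dist_commute)
    ultimately show ?thesis
      using U(2) assms(1) unfolding constant_on_def by (metis IntI atLeast_iff)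
  qed
  then show ?thesis unfolding in_F_iff using assms(1) by blast
qed

lemma in_F_rightI:
  assumes "0 \<le> x" "\<And>y. x < y \<Longrightarrow> S x < S y"
  shows "x \<in> F"
proof (rule in_FI[OF assms(1)])
  fix e :: real assume "0 < e"
  then show "\<exists>y\<ge>0. dist y x < e \<and> S y \<noteq> S x"
    using assms(1) assms(2)[of "x + e/2"] by (intro exI[of _ "x + e/2"]) (auto simp: dist_real_def)
qed

lemma not_in_F_level:
  assumes "0 \<le> u" "u < x" "x < v" "S u = S v"
  shows "x \<notin> F"
proof -
  have "S constant_on {u<..<v} \<inter> {0..}"
    unfolding constant_on_def
  proof (intro exI[of _ "S u"] ballI)
    fix y assume "y \<in> {u<..<v} \<inter> {0..}"
    then show "S y = S u" using assms staircase_mono[of u y] staircase_mono[of y v] by auto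
  qed
  moreover have "open {u<..<v}" "x \<in> {u<..<v}" using assms by auto
  ultimately show ?thesis unfolding in_F_iff by blast
qed

section \<open>Extreme points of the level sets\<close>

definition upper_inv :: "real \<Rightarrow> real" where
  "upper_inv s = Sup {x. 0 \<le> x \<and> S x = s}"

definition lower_inv :: "real \<Rightarrow> real" where
  "lower_inv s = Inf {x. 0 \<le> x \<and> S x = s}"

text \<open>The level set is closed, nonempty by the intermediate value theorem and bounded because
  S tends to infinity, so both extremes are attained. Strict growth to the right puts the upper one
  into \<open>F\<close>. The lower one is not claimed to lie in \<open>F\<close>: at level 0 it is
  the point 0, near which S may be constant.\<close>

lemma
  assumes "0 \<le> s"
  shows upper_inv_nonneg: "0 \<le> upper_inv s"
    and staircase_upper_inv [simp]: "S (upper_inv s) = s"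
    and less_staircase: "upper_inv s < y \<Longrightarrow> s < S y"
    and upper_inv_in_F: "upper_inv s \<in> F"
    and lower_inv_nonneg: "0 \<le> lower_inv s"
    and staircase_lower_inv [simp]: "S (lower_inv s) = s"
    and staircase_less: "0 \<le> y \<Longrightarrow> y < lower_inv s \<Longrightarrow> S y < s"
    and lower_inv_le_upper_inv: "lower_inv s \<le> upper_inv s"
proof -
  let ?T = "{x. 0 \<le> x \<and> S x = s}"
  have ne: "?T \<noteq> {}" using ex_level[OF assms] by auto
  obtain N where N: "\<And>z. z \<ge> N \<Longrightarrow> s < S z" using ex_staircase_gt by blast
  have bdd: "bdd_above ?T"
  proof (rule bdd_aboveI[of _ N])
    fix x assume "x \<in> ?T"
    then show "x \<le> N" using N[of x] by (cases "N \<le> x") auto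
  qed
  have bdd': "bdd_below ?T" by (rule bdd_belowI[of _ 0]) auto
  have U: "upper_inv s \<in> ?T"
    unfolding upper_inv_def by (rule closed_contains_Sup[OF ne bdd closed_level])
  have L: "lower_inv s \<in> ?T"
    unfolding lower_inv_def by (rule closed_contains_Inf[OF ne bdd' closed_level])
  show "0 \<le> upper_inv s" "S (upper_inv s) = s" "0 \<le> lower_inv s" "S (lower_inv s) = s"
    using U L by auto
  have *: "s < S y" if "upper_inv s < y" for y
  proof -
    have "y \<notin> ?T" using that cSup_upper[OF _ bdd, of y] by (auto simp: upper_inv_def)
    moreover have "s \<le> S y" using U staircase_mono[of "upper_inv s" y] that by auto
    ultimately show ?thesis using U that by auto
  qed
  then show "upper_inv s < y \<Longrightarrow> s < S y" .
  show "upper_inv s \<in> F" by (rule in_F_rightI) (use * U in auto)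
  show "S y < s" if "0 \<le> y" "y < lower_inv s"
  proof -
    have "y \<notin> ?T" using that cInf_lower[OF _ bdd', of y] by (auto simp: lower_inv_def)
    moreover have "S y \<le> s" using L staircase_mono[of y "lower_inv s"] that by auto
    ultimately show ?thesis using that by auto
  qed
  show "lower_inv s \<le> upper_inv s"
    using * L by (force simp: not_le[symmetric])
qed

lemma lower_inv_pos: "0 < s \<Longrightarrow> 0 < lower_inv s"
  using lower_inv_nonneg[of s] staircase_lower_inv[of s] staircase_0 by (cases "lower_inv s = 0") auto

lemma lower_inv_le: "0 \<le> x \<Longrightarrow> lower_inv (S x) \<le> x"
  using staircase_less[of "S x" x] staircase_nonneg by force

lemma le_upper_inv: "0 \<le> x \<Longrightarrow> x \<le> upper_inv (S x)"
  using less_staircase[of "S x" x] staircase_nonneg by force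

text \<open>Together the two bounds put \<open>upper_inv s\<close> into every [u, v] with S u \<le>
  s < S v; this is how it is located in the cells of a subdivision.\<close>

lemma upper_inv_bounds:
  assumes "0 \<le> s"
  shows "S u \<le> s \<Longrightarrow> u \<le> upper_inv s" and "0 \<le> v \<Longrightarrow> s < S v \<Longrightarrow> upper_inv s < v"
proof -
  show "S u \<le> s \<Longrightarrow> u \<le> upper_inv s" using less_staircase[OF assms, of u] by force
  show "0 \<le> v \<Longrightarrow> s < S v \<Longrightarrow> upper_inv s < v"
    using staircase_mono[of v "upper_inv s"] assms by force
qed

text \<open>Strictly inside a level set S is locally constant, so \<open>F\<close> meets each level
  in at most two points, the ends.\<close>

lemma F_cases:
  assumes "x \<in> F"
  shows "x = lower_inv (S x) \<or> x = upper_inv (S x)"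
proof (rule ccontr)
  have x: "0 \<le> x" using F_nonneg[OF assms] .
  assume "\<not> ?thesis"
  then have "lower_inv (S x) < x" "x < upper_inv (S x)"
    using lower_inv_le[OF x] le_upper_inv[OF x] by auto
  then have "x \<notin> F"
    by (rule not_in_F_level[rotated]) (use x staircase_nonneg[OF x] lower_inv_nonneg in auto)
  with assms show False by simp
qed

section \<open>F-limits and limits in the staircase variable\<close>

lemma filterlim_staircase_at:
  assumes "x \<in> F"
  shows "filterlim S (at (S x)) (at x within F)"
proof -
  have "(S \<longlongrightarrow> S x) (at x within F)"
    using continuous_on_subset[OF continuous_on_staircase, of F] F_nonneg assms
    by (auto simp: continuous_on_def subset_eq)
  \<comment> \<open>Within \<open>F\<close> the value S x can recur only at the opposite end of its
    level set. That is one fixed point different from x, so it is avoided close to x and the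
    denominators of the F-quotient do not vanish there.\<close>
  moreover have "\<forall>\<^sub>F y in at x within F. S y \<noteq> S x"
  proof -
    have "open (- ({lower_inv (S x), upper_inv (S x)} - {x}))"
      by (intro open_Compl finite_imp_closed) auto
    then have "\<forall>\<^sub>F y in at x within F. y \<in> - ({lower_inv (S x), upper_inv (S x)} - {x})"
      by (rule topological_tendstoD[OF tendsto_ident_at]) auto
    moreover have "\<forall>\<^sub>F y in at x within F. y \<in> F \<and> y \<noteq> x"
      by (auto simp: eventually_at_filter)
    ultimately show ?thesis
      by eventually_elim (use F_cases in fastforce)
  qed
  ultimately show ?thesis by (simp add: filterlim_at)
qed

text \<open>This makes the limit selected in \<open>F_deriv\<close> unique. A last point of its
  level is approached by \<open>upper_inv s\<close> with s slightly above S x, a first point by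
  \<open>upper_inv s\<close> with s slightly below.\<close>

lemma F_islimpt:
  assumes "x \<in> F" "0 < S x"
  shows "x islimpt F"
  unfolding islimpt_approachable
proof (intro allI impI)
  fix e :: real assume e: "e > 0"
  have x: "0 < x" using F_nonneg[OF assms(1)] assms(2) by (cases "x = 0") auto
  show "\<exists>y\<in>F. y \<noteq> x \<and> dist y x < e"
  proof (cases "x = upper_inv (S x)")
    case True
    define s where "s = (S x + S (x + e)) / 2"
    have "S x < S (x + e)" using less_staircase[of "S x" "x + e"] True e assms(2) by auto
    then have s: "S x < s" "s < S (x + e)" "0 \<le> s" using assms(2) by (auto simp: s_def field_simps)
    have "x \<le> upper_inv s" "upper_inv s < x + e"
      using upper_inv_bounds[of s x] upper_inv_bounds(2)[of s "x + e"] s x e by auto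
    moreover have "upper_inv s \<noteq> x" using s staircase_upper_inv by force
    ultimately show ?thesis using upper_inv_in_F[OF s(3)] by (intro bexI) (auto simp: dist_real_def)
  next
    case False
    then have xl: "x = lower_inv (S x)" using F_cases[OF assms(1)] by auto
    define z where "z = max 0 (x - e/2)"
    define s where "s = (S x + S z) / 2"
    have z: "0 \<le> z" "z < x" "x - e < z" using x e by (auto simp: z_def)
    have "S z < S x" using staircase_less[of "S x" z] xl z assms(2) by auto
    then have s: "S z < s" "s < S x" "0 \<le> s"
      using assms(2) staircase_nonneg[OF z(1)] by (auto simp: s_def field_simps)
    have "z \<le> upper_inv s" "upper_inv s < x"
      using upper_inv_bounds[of s z] upper_inv_bounds(2)[of s x] s z by auto
    then show ?thesis using upper_inv_in_F[OF s(3)] z by (intro bexI) (auto simp: dist_real_def)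
  qed
qed

text \<open>The F-quotient is the ordinary quotient of p composed with S. This direction serves
  existence and holds at every point of \<open>F\<close> of positive level, gap ends
  included.\<close>

lemma F_derivative_composition:
  assumes "x \<in> F" "0 < S x" "(p has_real_derivative D) (at (S x))"
  shows "F_differentiable \<alpha> F (\<lambda>u. p (S u)) x" and "F_deriv \<alpha> F (\<lambda>u. p (S u)) x = D"
proof -
  have "((\<lambda>v. (p v - p (S x)) / (v - S x)) \<longlongrightarrow> D) (at (S x))"
    using assms(3) by (simp add: has_field_derivative_iff)
  from filterlim_compose[OF this filterlim_staircase_at[OF assms(1)]]
  have lim: "(F_quotient \<alpha> F (\<lambda>u. p (S u)) x \<longlongrightarrow> D) (at x within F)"
    unfolding F_quotient_def .
  then show "F_differentiable \<alpha> F (\<lambda>u. p (S u)) x" unfolding F_differentiable_def by blast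
  have "at x within F \<noteq> bot" using F_islimpt assms(1,2) by (simp add: trivial_limit_within)
  from tendsto_Lim[OF this lim] show "F_deriv \<alpha> F (\<lambda>u. p (S u)) x = D"
    using assms(1) by (simp add: F_deriv_def)
qed

definition gap_values :: "real set" where
  "gap_values = {s. 0 \<le> s \<and> lower_inv s < upper_inv s}"

text \<open>A nondegenerate level interval contains a rational number, at which S takes the
  corresponding value.\<close>

lemma countable_gap_values: "countable gap_values"
proof -
  have "gap_values \<subseteq> S ` \<rat>"
  proof
    fix s assume "s \<in> gap_values"
    then have s: "0 \<le> s" "lower_inv s < upper_inv s" by (auto simp: gap_values_def)
    obtain r where r: "r \<in> \<rat>" "lower_inv s < r" "r < upper_inv s"
      using Rats_dense_in_real[OF s(2)] by blast
    have "S r = s"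
      using staircase_mono[of "lower_inv s" r] staircase_mono[of r "upper_inv s"] r
        lower_inv_nonneg[OF s(1)] s by auto
    then show "s \<in> S ` \<rat>" using r by auto
  qed
  then show ?thesis by (rule countable_subset) (simp add: countable_rat)
qed

text \<open>Off the gap values the level set is a single point x, so S is strictly below s to the
  left of x and strictly above s to its right, which squeezes \<open>upper_inv r\<close>. At a gap
  value \<open>upper_inv\<close> jumps.\<close>

lemma filterlim_upper_inv:
  assumes "0 < s" "s \<notin> gap_values"
  shows "filterlim upper_inv (at (upper_inv s) within F) (at s)"
  unfolding filterlim_at
proof
  define x where "x = upper_inv s"
  have x: "x \<in> F" "S x = s" "x = lower_inv s" "0 < x"
    using assms upper_inv_in_F[of s] lower_inv_le_upper_inv[of s] lower_inv_pos[of s]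
    by (auto simp: x_def gap_values_def)
  have ev: "\<forall>\<^sub>F r in at s. 0 < r \<and> r \<noteq> s"
    using order_tendstoD(1)[OF tendsto_ident_at assms(1), of UNIV]
    by (auto simp: eventually_at_filter elim: eventually_mono)
  then show "\<forall>\<^sub>F r in at s. upper_inv r \<in> F \<and> upper_inv r \<noteq> upper_inv s"
    unfolding x_def[symmetric] by eventually_elim (use upper_inv_in_F staircase_upper_inv x in force)
  show "(upper_inv \<longlongrightarrow> upper_inv s) (at s)"
    unfolding x_def[symmetric]
  proof (rule order_tendstoI)
    fix y assume "y < x"
    \<comment> \<open>The midpoint of \<open>max 0 y\<close> and x lies strictly between y and x and
      stays on the half-line, where S is monotone.\<close>
    then have "\<forall>\<^sub>F r in at s. S (max 0 ((x + max 0 y)/2)) < r"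
      using staircase_less[of s "max 0 ((x + max 0 y)/2)"] x assms(1)
      by (intro order_tendstoD[OF tendsto_ident_at]) auto
    with ev show "\<forall>\<^sub>F r in at s. y < upper_inv r"
    proof eventually_elim
      case (elim r)
      have "y < max 0 ((x + max 0 y)/2)" using \<open>y < x\<close> x by auto
      also have "\<dots> \<le> upper_inv r" by (rule upper_inv_bounds(1)) (use elim in auto)
      finally show ?case .
    qed
  next
    fix y assume y: "x < y"
    then have "\<forall>\<^sub>F r in at s. r < S y"
      using less_staircase[of s y] assms(1)
      by (intro order_tendstoD[OF tendsto_ident_at]) (auto simp: x_def)
    with ev show "\<forall>\<^sub>F r in at s. upper_inv r < y"
      by eventually_elim (use upper_inv_bounds(2) y x in auto)
  qed
qed

text \<open>Converse direction, for uniqueness: since \<open>upper_inv\<close> is a right inverse of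
  S, substituting \<open>upper_inv r\<close> into the F-quotient gives the ordinary quotient of p
  between s and r.\<close>

lemma F_differentiable_imp_derivative:
  assumes "F_differentiable \<alpha> F (\<lambda>u. p (S u)) (upper_inv s)" "0 < s" "s \<notin> gap_values"
  shows "(p has_real_derivative F_deriv \<alpha> F (\<lambda>u. p (S u)) (upper_inv s)) (at s)"
proof -
  define x where "x = upper_inv s"
  have x: "x \<in> F" "S x = s" using assms(2) upper_inv_in_F[of s] by (auto simp: x_def)
  obtain D where D: "(F_quotient \<alpha> F (\<lambda>u. p (S u)) x \<longlongrightarrow> D) (at x within F)"
    using assms(1) by (auto simp: F_differentiable_def x_def)
  have "at x within F \<noteq> bot" using F_islimpt[of x] x assms(2) by (simp add: trivial_limit_within)
  from tendsto_Lim[OF this D] have dD: "F_deriv \<alpha> F (\<lambda>u. p (S u)) x = D"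
    using x by (simp add: F_deriv_def)
  from filterlim_compose[OF D filterlim_upper_inv[OF assms(2,3), folded x_def]]
  have "((\<lambda>r. F_quotient \<alpha> F (\<lambda>u. p (S u)) x (upper_inv r)) \<longlongrightarrow> D) (at s)" .
  moreover have "\<forall>\<^sub>F r in at s. F_quotient \<alpha> F (\<lambda>u. p (S u)) x (upper_inv r) = (p r - p s) / (r - s)"
    using order_tendstoD(1)[OF tendsto_ident_at assms(2), of UNIV]
    by (auto elim!: eventually_mono simp: F_quotient_def x(2))
  ultimately have "((\<lambda>r. (p r - p s) / (r - s)) \<longlongrightarrow> D) (at s)"
    by (simp cong: tendsto_cong)
  then show ?thesis by (simp add: has_field_derivative_iff dD flip: x_def)
qed

end

subsection \<open>\<open>F\<close>-integrals as integrals over the range of the staircase\<close>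

text \<open>The nodes are only weakly increasing, because they will be values of S, which may be
  constant on a cell.\<close>

lemma step_function_below:
  fixes z m :: "nat \<Rightarrow> real" and f :: "real \<Rightarrow> real"
  assumes "\<And>i. i < n \<Longrightarrow> z i \<le> z (Suc i)"
    and "\<And>i s. i < n \<Longrightarrow> z i \<le> s \<Longrightarrow> s < z (Suc i) \<Longrightarrow> m i \<le> f s"
  shows "\<exists>g. (g has_integral (\<Sum>i<n. m i * (z (Suc i) - z i))) {z 0..z n} \<and>
    (\<forall>s\<in>{z 0..z n}. g s \<le> f s)"
  using assms
proof (induction n)
  case 0
  show ?case by (intro exI[of _ f]) (auto intro: has_integral_refl)
next
  case (Suc n)
  have "\<exists>g. (g has_integral (\<Sum>i<n. m i * (z (Suc i) - z i))) {z 0..z n} \<and> (\<forall>s\<in>{z 0..z n}. g s \<le> f s)"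
    by (rule Suc.IH) (use Suc.prems less_SucI in blast)+
  then obtain g where g: "(g has_integral (\<Sum>i<n. m i * (z (Suc i) - z i))) {z 0..z n}"
    "\<And>s. s \<in> {z 0..z n} \<Longrightarrow> g s \<le> f s" by blast
  have le: "z 0 \<le> z n" "z n \<le> z (Suc n)"
    using lift_Suc_mono_le[of "\<lambda>i. z (min i n)" 0 n] Suc.prems(1)
    by (auto simp: min_def not_le le_Suc_eq Suc_le_eq)
  \<comment> \<open>The hypothesis covers half-open cells only. At the final node the step function
    copies f, which keeps the inequality and changes the integral at no more than one point.\<close>
  define g' where "g' = (\<lambda>s. if s < z n then g s else if s < z (Suc n) then m n else f s)"
  have 1: "(g' has_integral (\<Sum>i<n. m i * (z (Suc i) - z i))) {z 0..z n}"
    by (rule has_integral_spike_finite[of "{z n}", OF _ _ g(1)]) (auto simp: g'_def)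
  have "((\<lambda>s. m n) has_integral m n * (z (Suc n) - z n)) {z n..z (Suc n)}"
    using has_integral_const_real[of "m n" "z n" "z (Suc n)"] le by (simp add: mult.commute)
  then have 2: "(g' has_integral m n * (z (Suc n) - z n)) {z n..z (Suc n)}"
    by (rule has_integral_spike_finite[of "{z (Suc n)}", rotated 2]) (auto simp: g'_def)
  have "(g' has_integral (\<Sum>i<Suc n. m i * (z (Suc i) - z i))) {z 0..z (Suc n)}"
    using has_integral_combine[OF le 1 2] by simp
  moreover have "g' s \<le> f s" if "s \<in> {z 0..z (Suc n)}" for s
    using that g(2)[of s] Suc.prems(2)[of n s] by (auto simp: g'_def)
  ultimately show ?case by blast
qed

section \<open>Proper F-integrals\<close>

context fractal
begin

lemma bounded_image_F:
  fixes h :: "real \<Rightarrow> real"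
  assumes "bounded (h ` (F \<inter> {c..d}))" "subdivision c d n x" "i < n"
  shows "bdd_below (h ` (F \<inter> {x i..x (Suc i)}))" "bdd_above (h ` (F \<inter> {x i..x (Suc i)}))"
proof -
  have "h ` (F \<inter> {x i..x (Suc i)}) \<subseteq> h ` (F \<inter> {c..d})"
    using subdivision_bounds[OF assms(2), of i] subdivision_bounds[OF assms(2), of "Suc i"] assms(3)
    by (intro image_mono) auto
  then have "bounded (h ` (F \<inter> {x i..x (Suc i)}))" using assms(1) bounded_subset by blast
  then show "bdd_below (h ` (F \<inter> {x i..x (Suc i)}))" "bdd_above (h ` (F \<inter> {x i..x (Suc i)}))"
    by (simp_all add: bounded_imp_bdd_below bounded_imp_bdd_above)
qed

text \<open>A cell on which S does not grow has weight 0. On any other cell each value s with S (x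
  i) \<le> s < S (x (i+1)) has \<open>upper_inv s\<close> in the cell and in \<open>F\<close>, so
  the infimum and supremum there enclose h at that point, and the default 0 for empty cells never
  enters. The value s = S d is left free because \<open>upper_inv (S d)\<close> may lie beyond
  d.\<close>

lemma sums_step_functions:
  assumes "0 \<le> c" "subdivision c d n x" "bounded (h ` (F \<inter> {c..d}))"
    and f: "\<And>s. S c \<le> s \<Longrightarrow> s < S d \<Longrightarrow> f s = h (upper_inv s)"
  shows "\<exists>g. (g has_integral lower_sum \<alpha> F h n x) {S c..S d} \<and> (\<forall>s\<in>{S c..S d}. g s \<le> f s)"
    and "\<exists>g. (g has_integral upper_sum \<alpha> F h n x) {S c..S d} \<and> (\<forall>s\<in>{S c..S d}. f s \<le> g s)"
proof -
  have x0: "x 0 = c" "x n = d" using assms(2) by (auto simp: subdivision_def)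
  have xb: "c \<le> x i" "x i \<le> d" if "i \<le> n" for i using subdivision_bounds[OF assms(2) that] by auto
  have mono: "S (x i) \<le> S (x (Suc i))" if "i < n" for i
    using that xb[of i] assms(1,2) by (intro staircase_mono) (auto simp: subdivision_def)
  have mem: "upper_inv s \<in> F \<inter> {x i..x (Suc i)}" "f s = h (upper_inv s)"
    if "i < n" "S (x i) \<le> s" "s < S (x (Suc i))" for i s
  proof -
    have "S c \<le> S (x i)" "S (x (Suc i)) \<le> S d"
      using xb[of i] xb[of "Suc i"] that assms(1) by (auto intro!: staircase_mono)
    with that show "f s = h (upper_inv s)" by (intro f) auto
    have s: "0 \<le> s" using that staircase_nonneg[of "x i"] xb[of i] assms(1) by auto
    show "upper_inv s \<in> F \<inter> {x i..x (Suc i)}"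
      using upper_inv_in_F[OF s] upper_inv_bounds(1)[OF s, of "x i"]
        upper_inv_bounds(2)[OF s, of "x (Suc i)"] that xb[of "Suc i"] assms(1) by auto
  qed
  define m where "m = (\<lambda>i. if F \<inter> {x i..x (Suc i)} = {} then 0 else INF y\<in>F \<inter> {x i..x (Suc i)}. h y)"
  define M where "M = (\<lambda>i. if F \<inter> {x i..x (Suc i)} = {} then 0 else SUP y\<in>F \<inter> {x i..x (Suc i)}. h y)"
  have "m i \<le> f s" if "i < n" "S (x i) \<le> s" "s < S (x (Suc i))" for i s
    using mem[OF that] bounded_image_F(1)[OF assms(3,2) that(1)]
    by (auto simp: m_def intro!: cINF_lower)
  from step_function_below[of n "\<lambda>i. S (x i)" m f, OF mono this]
  show "\<exists>g. (g has_integral lower_sum \<alpha> F h n x) {S c..S d} \<and> (\<forall>s\<in>{S c..S d}. g s \<le> f s)"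
    by (auto simp: lower_sum_def m_def x0)
  \<comment> \<open>The upper bound is the lower bound applied to negated heights and negated
    f.\<close>
  have "- M i \<le> - f s" if "i < n" "S (x i) \<le> s" "s < S (x (Suc i))" for i s
    using mem[OF that] bounded_image_F(2)[OF assms(3,2) that(1)]
    by (auto simp: M_def intro!: cSUP_upper)
  from step_function_below[of n "\<lambda>i. S (x i)" "\<lambda>i. - M i" "\<lambda>s. - f s", OF mono this]
  obtain g where g: "(g has_integral (\<Sum>i<n. - M i * (S (x (Suc i)) - S (x i)))) {S c..S d}"
    "\<forall>s\<in>{S c..S d}. g s \<le> - f s" by (auto simp: x0)
  have "(\<Sum>i<n. - M i * (S (x (Suc i)) - S (x i))) = - upper_sum \<alpha> F h n x"
    by (simp add: upper_sum_def M_def sum_negf)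
  with g(1) has_integral_neg[OF g(1)] g(2)
  show "\<exists>g. (g has_integral upper_sum \<alpha> F h n x) {S c..S d} \<and> (\<forall>s\<in>{S c..S d}. f s \<le> g s)"
    by (intro exI[of _ "\<lambda>s. - g s"]) (auto simp: le_minus_iff)
qed

lemma ex_subdivision:
  assumes "c \<le> d" "0 < \<delta>"
  shows "\<exists>n x. subdivision c d n x \<and> (\<forall>i<n. x (Suc i) - x i < \<delta>)"
proof (cases "c = d")
  case True
  then show ?thesis by (intro exI[of _ 0] exI[of _ "\<lambda>_. c"]) (simp add: subdivision_0)
next
  case False
  then have cd: "c < d" using assms by simp
  obtain n where n: "n > 0" "(d - c) / \<delta> < real n"
    by (metis reals_Archimedean2 cd assms(2) diff_gt_0_iff_gt divide_pos_pos less_trans of_nat_0_less_iff)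
  have step: "(d - c) / real n < \<delta>" using n assms(2) by (simp add: field_simps)
  define x where "x = (\<lambda>i. c + real i * ((d - c) / real n))"
  have d: "x (Suc i) - x i = (d - c) / real n" for i by (simp add: x_def distrib_right add_divide_distrib)
  have pos: "0 < (d - c) / real n" using cd n by simp
  have "subdivision c d n x"
    unfolding subdivision_def
  proof (intro conjI allI impI)
    show "x i < x (Suc i)" for i using d[of i] pos by linarith
  qed (use n in \<open>auto simp: x_def\<close>)
  then show ?thesis using d step by (intro exI[of _ n] exI[of _ x]) auto
qed

text \<open>Sums close to the common extremal value I give step functions on both sides of the
  transported function with integrals within e of I, which yields integrability and the value at
  once.\<close>

lemma has_proper_F_integral_imp:
  assumes "has_proper_F_integral \<alpha> F h c d I" "0 \<le> c"
  shows "((\<lambda>s. h (upper_inv s)) has_integral I) {S c..S d}"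
proof -
  let ?f = "\<lambda>s. h (upper_inv s)"
  let ?A = "{(n, x). subdivision c d n x}"
  have cd: "c \<le> d" and bdd: "bounded (h ` (F \<inter> {c..d}))"
    and INF: "(INF (n, x)\<in>?A. upper_sum \<alpha> F h n x) = I"
    and SUP: "(SUP (n, x)\<in>?A. lower_sum \<alpha> F h n x) = I"
    using assms(1) unfolding has_proper_F_integral_def by auto
  have ne: "?A \<noteq> {}" using ex_subdivision[OF cd, of 1] by auto
  have *: "\<exists>g h i j. (g has_integral i) {S c..S d} \<and> (h has_integral j) {S c..S d} \<and>
      I - e < i \<and> j < I + e \<and> (\<forall>x\<in>{S c..S d}. g x \<le> ?f x \<and> ?f x \<le> h x)" if e: "e > 0" for e
  proof -
    have "I - e < (SUP (n, x)\<in>?A. lower_sum \<alpha> F h n x)" using SUP e by simp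
    from less_cSupD[OF _ this] ne obtain n x where
      1: "subdivision c d n x" "I - e < lower_sum \<alpha> F h n x" by auto
    have "(INF (n, x)\<in>?A. upper_sum \<alpha> F h n x) < I + e" using INF e by simp
    from cInf_lessD[OF _ this] ne obtain n' x' where
      2: "subdivision c d n' x'" "upper_sum \<alpha> F h n' x' < I + e" by auto
    show ?thesis
      using sums_step_functions(1)[OF assms(2) 1(1) bdd, of ?f] sums_step_functions(2)[OF assms(2) 2(1) bdd, of ?f]
        1(2) 2(2) by blast
  qed
  have int: "?f integrable_on {S c..S d}"
  proof (rule integrable_straddle)
    fix e :: real assume e: "e > 0"
    from *[of "e/2"] e obtain g h i j where
      1: "(g has_integral i) {S c..S d}" "(h has_integral j) {S c..S d}"
      "I - e/2 < i" "j < I + e/2" "\<forall>x\<in>{S c..S d}. g x \<le> ?f x \<and> ?f x \<le> h x" by auto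
    have "i \<le> j" by (rule has_integral_le[OF 1(1,2)]) (use 1(5) in force)
    then show "\<exists>g h i j. (g has_integral i) {S c..S d} \<and> (h has_integral j) {S c..S d} \<and>
                     \<bar>i - j\<bar> < e \<and> (\<forall>x\<in>{S c..S d}. g x \<le> ?f x \<and> ?f x \<le> h x)"
      using 1 by (intro exI[of _ g] exI[of _ h] exI[of _ i] exI[of _ j]) auto
  qed
  let ?J = "integral {S c..S d} ?f"
  have "\<bar>?J - I\<bar> \<le> 0 + e" if e: "e > 0" for e
  proof -
    from *[OF e] obtain g h i j where
      1: "(g has_integral i) {S c..S d}" "(h has_integral j) {S c..S d}"
      "I - e < i" "j < I + e" "\<forall>x\<in>{S c..S d}. g x \<le> ?f x \<and> ?f x \<le> h x" by auto
    have "i \<le> ?J" by (rule has_integral_le[OF 1(1) integrable_integral[OF int]]) (use 1(5) in blast)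
    moreover have "?J \<le> j" by (rule has_integral_le[OF integrable_integral[OF int] 1(2)]) (use 1(5) in blast)
    ultimately show ?thesis using 1 by auto
  qed
  then have "?J = I" using field_le_epsilon[of "\<bar>?J - I\<bar>" 0] by simp
  then show ?thesis using int by (simp add: has_integral_iff)
qed

text \<open>All lower and upper sums enclose the integral of f by the step function bounds. Uniform
  continuity of f composed with S makes the oscillation on the cells of a fine subdivision small, so
  the extremal values coincide.\<close>

lemma has_proper_F_integralI:
  assumes "0 \<le> c" "c \<le> d" "continuous_on {S c..S d} f"
    and h: "\<And>y. y \<in> F \<Longrightarrow> c \<le> y \<Longrightarrow> y \<le> d \<Longrightarrow> h y = f (S y)"
  shows "has_proper_F_integral \<alpha> F h c d (integral {S c..S d} f)"
proof -
  let ?A = "{(n, x). subdivision c d n x}"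
  let ?I = "integral {S c..S d} f"
  have S_in: "S y \<in> {S c..S d}" if "c \<le> y" "y \<le> d" for y
    using that assms by (auto intro!: staircase_mono)
  have cfS: "continuous_on {c..d} (\<lambda>y. f (S y))"
    using assms S_in
    by (intro continuous_on_compose2[OF assms(3)] continuous_on_subset[OF continuous_on_staircase]) auto
  have "bounded (f ` {S c..S d})"
    using assms(3) by (intro compact_imp_bounded compact_continuous_image) auto
  moreover have "h ` (F \<inter> {c..d}) \<subseteq> f ` {S c..S d}" using h S_in by auto
  ultimately have bdd: "bounded (h ` (F \<inter> {c..d}))" using bounded_subset by blast
  have f_int: "(f has_integral ?I) {S c..S d}"
    using assms(3) by (intro integrable_integral integrable_continuous_real)
  have f: "f s = h (upper_inv s)" if "S c \<le> s" "s < S d" for s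
  proof -
    have s: "0 \<le> s" using that staircase_nonneg[OF assms(1)] by simp
    show ?thesis
      using upper_inv_bounds(1)[OF s, of c] upper_inv_bounds(2)[OF s, of d] that assms(1,2)
        h[OF upper_inv_in_F[OF s]] s by auto
  qed
  have lower: "lower_sum \<alpha> F h n x \<le> ?I" and upper: "?I \<le> upper_sum \<alpha> F h n x"
    if sub: "subdivision c d n x" for n x
  proof -
    obtain g where "(g has_integral lower_sum \<alpha> F h n x) {S c..S d}" "\<forall>s\<in>{S c..S d}. g s \<le> f s"
      using sums_step_functions(1)[OF assms(1) sub bdd f] by blast
    then show "lower_sum \<alpha> F h n x \<le> ?I" using f_int by (blast intro: has_integral_le)
    obtain g where "(g has_integral upper_sum \<alpha> F h n x) {S c..S d}" "\<forall>s\<in>{S c..S d}. f s \<le> g s"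
      using sums_step_functions(2)[OF assms(1) sub bdd f] by blast
    then show "?I \<le> upper_sum \<alpha> F h n x" using f_int by (blast intro: has_integral_le)
  qed
  have close: "\<exists>n x. subdivision c d n x \<and> upper_sum \<alpha> F h n x \<le> lower_sum \<alpha> F h n x + e" if e: "e > 0" for e
  proof -
    \<comment> \<open>The summand 1 keeps the denominator positive when S is constant on
      [c, d].\<close>
    define e' where "e' = e / (S d - S c + 1)"
    have Scd: "S c \<le> S d" using assms by (intro staircase_mono)
    then have e': "e' > 0" "e' * (S d - S c) \<le> e" using e
      by (auto simp: e'_def field_simps)
    have "uniformly_continuous_on {c..d} (\<lambda>y. f (S y))"
      using cfS by (intro compact_uniformly_continuous) auto
    then obtain \<delta> where \<delta>: "\<delta> > 0"
      "\<And>y y'. y \<in> {c..d} \<Longrightarrow> y' \<in> {c..d} \<Longrightarrow> dist y' y < \<delta> \<Longrightarrow> dist (f (S y')) (f (S y)) < e'"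
      using e'(1) unfolding uniformly_continuous_on_def by meson
    obtain n x where nx: "subdivision c d n x" "\<And>i. i < n \<Longrightarrow> x (Suc i) - x i < \<delta>"
      using ex_subdivision[OF assms(2) \<delta>(1)] by blast
    have "upper_sum \<alpha> F h n x \<le> (\<Sum>i<n. ((if F \<inter> {x i..x (Suc i)} = {} then 0 else INF y\<in>F \<inter> {x i..x (Suc i)}. h y) + e')
       * (S (x (Suc i)) - S (x i)))"
      unfolding upper_sum_def
    proof (intro sum_mono mult_right_mono)
      fix i assume "i \<in> {..<n}"
      then have i: "i < n" by simp
      have b: "c \<le> x i" "x i < x (Suc i)" "x (Suc i) \<le> d"
        using subdivision_bounds[OF nx(1), of i] subdivision_bounds[OF nx(1), of "Suc i"] i nx(1)
        by (auto simp: subdivision_def)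
      show "0 \<le> S (x (Suc i)) - S (x i)" using b assms(1) staircase_mono[of "x i" "x (Suc i)"] by auto
      let ?B = "F \<inter> {x i..x (Suc i)}"
      show "(if ?B = {} then 0 else SUP y\<in>?B. h y) \<le> (if ?B = {} then 0 else INF y\<in>?B. h y) + e'"
      proof (cases "?B = {}")
        case False
        have "h y - e' \<le> h y'" if "y \<in> ?B" "y' \<in> ?B" for y y'
        proof -
          have "dist (f (S y')) (f (S y)) < e'"
            by (rule \<delta>(2)) (use that b nx(2)[OF i] in \<open>auto simp: dist_real_def\<close>)
          then show ?thesis using that b h[of y] h[of y'] by (auto simp: dist_real_def)
        qed
        then have "h y - e' \<le> (INF y\<in>?B. h y)" if "y \<in> ?B" for y
          using False that by (intro cINF_greatest) auto
        then have "(SUP y\<in>?B. h y) \<le> (INF y\<in>?B. h y) + e'"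
          using False by (intro cSUP_least) (auto simp: algebra_simps)
        then show ?thesis using False by simp
      qed (use e' in simp)
    qed
    also have "\<dots> = lower_sum \<alpha> F h n x + e' * (\<Sum>i<n. S (x (Suc i)) - S (x i))"
      unfolding lower_sum_def distrib_right sum.distrib by (simp add: sum_distrib_left)
    also have "(\<Sum>i<n. S (x (Suc i)) - S (x i)) = S d - S c"
      using nx(1) by (subst sum_lessThan_telescope) (simp add: subdivision_def)
    finally show ?thesis using e' nx(1) by (intro exI[of _ n] exI[of _ x]) auto
  qed
  have ne: "?A \<noteq> {}" using ex_subdivision[OF assms(2), of 1] by auto
  have bb: "bdd_below ((\<lambda>(n, x). upper_sum \<alpha> F h n x) ` ?A)"
    by (rule bdd_belowI[of _ ?I]) (use upper in auto)
  have ba: "bdd_above ((\<lambda>(n, x). lower_sum \<alpha> F h n x) ` ?A)"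
    by (rule bdd_aboveI[of _ ?I]) (use lower in auto)
  have "(INF (n, x)\<in>?A. upper_sum \<alpha> F h n x) = ?I"
  proof (rule antisym)
    show "?I \<le> (INF (n, x)\<in>?A. upper_sum \<alpha> F h n x)"
      by (rule cINF_greatest[OF ne]) (use upper in auto)
    show "(INF (n, x)\<in>?A. upper_sum \<alpha> F h n x) \<le> ?I"
    proof (rule field_le_epsilon)
      fix e :: real assume "e > 0"
      from close[OF this] obtain n x where *: "subdivision c d n x"
        "upper_sum \<alpha> F h n x \<le> lower_sum \<alpha> F h n x + e" by blast
      have "(INF (n, x)\<in>?A. upper_sum \<alpha> F h n x) \<le> (case (n, x) of (n, x) \<Rightarrow> upper_sum \<alpha> F h n x)"
        by (rule cINF_lower[OF bb]) (use * in simp)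
      with * lower[OF *(1)] show "(INF (n, x)\<in>?A. upper_sum \<alpha> F h n x) \<le> ?I + e" by simp
    qed
  qed
  moreover have "(SUP (n, x)\<in>?A. lower_sum \<alpha> F h n x) = ?I"
  proof (rule antisym)
    show "(SUP (n, x)\<in>?A. lower_sum \<alpha> F h n x) \<le> ?I"
      by (rule cSUP_least[OF ne]) (use lower in auto)
    show "?I \<le> (SUP (n, x)\<in>?A. lower_sum \<alpha> F h n x)"
    proof (rule field_le_epsilon)
      fix e :: real assume "e > 0"
      from close[OF this] obtain n x where *: "subdivision c d n x"
        "upper_sum \<alpha> F h n x \<le> lower_sum \<alpha> F h n x + e" by blast
      have "(case (n, x) of (n, x) \<Rightarrow> lower_sum \<alpha> F h n x) \<le> (SUP (n, x)\<in>?A. lower_sum \<alpha> F h n x)"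
        by (rule cSUP_upper[OF _ ba]) (use * in simp)
      with * upper[OF *(1)] show "?I \<le> (SUP (n, x)\<in>?A. lower_sum \<alpha> F h n x) + e" by simp
    qed
  qed
  ultimately show ?thesis using bdd assms(2) unfolding has_proper_F_integral_def by simp
qed

section \<open>Improper F-integrals\<close>

definition improper_piece :: "(real \<Rightarrow> real) \<Rightarrow> real \<Rightarrow> real \<Rightarrow> real \<Rightarrow> bool" where
  "improper_piece h u v J \<longleftrightarrow> (\<exists>\<Phi>.
     (\<forall>c d. u < c \<longrightarrow> c < d \<longrightarrow> d < v \<longrightarrow> has_proper_F_integral \<alpha> F h c d (\<Phi> (c, d))) \<and>
     (\<Phi> \<longlongrightarrow> J) (at_right u \<times>\<^sub>F at_left v))"

lemma has_improper_F_integral_iff: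
  "has_improper_F_integral \<alpha> F h a b I \<longleftrightarrow>
     (\<exists>n x J. subdivision a b n x \<and> I = (\<Sum>i<n. J i) \<and> (\<forall>i<n. improper_piece h (x i) (x (Suc i)) (J i)))"
  unfolding has_improper_F_integral_def improper_piece_def ..

lemma has_improper_F_integral_refl: "has_improper_F_integral \<alpha> F h a a 0"
  unfolding has_improper_F_integral_iff
  by (intro exI[of _ 0] exI[of _ "\<lambda>_. a"]) (simp add: subdivision_0)

lemma has_improper_F_integral_snoc:
  assumes "has_improper_F_integral \<alpha> F h a u I" "u < v" "improper_piece h u v J"
  shows "has_improper_F_integral \<alpha> F h a v (I + J)"
proof -
  from assms(1) obtain n x K where 1: "subdivision a u n x" "I = (\<Sum>i<n. K i)"
    "\<And>i. i < n \<Longrightarrow> improper_piece h (x i) (x (Suc i)) (K i)"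
    unfolding has_improper_F_integral_iff by blast
  have "x n = u" using 1(1) by (simp add: subdivision_def)
  then have "improper_piece h ((x(Suc n := v)) i) ((x(Suc n := v)) (Suc i)) ((K(n := J)) i)"
    if "i < Suc n" for i
    using that 1(3)[of i] assms(3) by (auto simp: less_Suc_eq)
  moreover have "I + J = (\<Sum>i<Suc n. (K(n := J)) i)" using 1(2) by simp
  moreover have "subdivision a v (Suc n) (x(Suc n := v))" by (rule subdivision_snoc[OF 1(1) assms(2)])
  ultimately show ?thesis unfolding has_improper_F_integral_iff by blast
qed

text \<open>Fills the stretches before S starts to grow and after it has reached its value at t,
  where \<open>F\<close> has no points and h is arbitrary.\<close>

lemma improper_piece_gap:
  assumes "0 \<le> u" "F \<inter> {u<..<v} = {}"
  shows "improper_piece h u v 0"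
  unfolding improper_piece_def
proof (intro exI[of _ "\<lambda>_. 0"] conjI allI impI)
  fix c d assume "u < c" "c < d" "d < v"
  then have "has_proper_F_integral \<alpha> F h c d (integral {S c..S d} (\<lambda>_. 0))"
    using assms by (intro has_proper_F_integralI) auto
  then show "has_proper_F_integral \<alpha> F h c d 0" by simp
qed simp

lemma tendsto_staircase:
  assumes "0 \<le> x"
  shows "(S \<longlongrightarrow> S x) (at_right x)" and "0 < x \<Longrightarrow> (S \<longlongrightarrow> S x) (at_left x)"
proof -
  have *: "(S \<longlongrightarrow> S x) (at x within {0..})"
    using continuous_on_staircase assms by (auto simp: continuous_on_def)
  show "(S \<longlongrightarrow> S x) (at_right x)" by (rule tendsto_within_subset[OF *]) (use assms in auto)
  assume "0 < x"
  have "(S \<longlongrightarrow> S x) (at x within {0..x})" by (rule tendsto_within_subset[OF *]) auto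
  then show "(S \<longlongrightarrow> S x) (at_left x)" using \<open>0 < x\<close> by (simp add: at_within_Icc_at_left)
qed

text \<open>The singular points are b, the last zero of S, and a, the first point where S reaches S
  t. Strictly between them S lies in (0, S t), where f is continuous; outside [b, a] only gaps are
  left.\<close>

lemma has_improper_F_integralI:
  assumes "0 \<le> t" "0 < S t" "continuous_on {0<..<S t} f" "f integrable_on {0..S t}"
    and h: "\<And>y. y \<in> F \<Longrightarrow> 0 < S y \<Longrightarrow> S y < S t \<Longrightarrow> h y = f (S y)"
  shows "has_improper_F_integral \<alpha> F h 0 t (integral {0..S t} f)"
proof -
  define b where "b = upper_inv 0"
  define a where "a = lower_inv (S t)"
  have b: "0 \<le> b" "S b = 0" and a: "0 < a" "S a = S t" "a \<le> t"
    using upper_inv_nonneg[of 0] lower_inv_pos[OF assms(2)] lower_inv_le[OF assms(1)] assms(2)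
    by (auto simp: a_def b_def)
  have ba: "b < a" using a b assms(2) staircase_mono[of a b] by force
  define G where "G = (\<lambda>r. integral {0..r} f)"
  have G: "continuous_on {0..S t} G"
    unfolding G_def by (rule indefinite_integral_continuous_1) fact
  \<comment> \<open>The integral over [c, d] is an increment of the antiderivative G along S.
    Continuity of G and S lets both ends converge independently.\<close>
  have "improper_piece h b a (G (S t))"
    unfolding improper_piece_def
  proof (intro exI[of _ "\<lambda>z. G (S (snd z)) - G (S (fst z))"] conjI allI impI)
    fix c d assume cd: "b < c" "c < d" "d < a"
    have c: "0 < S c" using less_staircase[of 0 c] cd(1) by (simp add: b_def)
    have d: "S d < S t" using staircase_less[of "S t" d] cd b(1) assms(2) by (simp add: a_def)
    have Scd: "S c \<le> S d" using cd b by (intro staircase_mono) auto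
    have "has_proper_F_integral \<alpha> F h c d (integral {S c..S d} f)"
    proof (rule has_proper_F_integralI)
      show "continuous_on {S c..S d} f"
        using assms(3) by (rule continuous_on_subset) (use c d in auto)
      show "h y = f (S y)" if "y \<in> F" "c \<le> y" "y \<le> d" for y
        using staircase_mono[of c y] staircase_mono[of y d] that c d cd b by (intro h) auto
    qed (use cd b in auto)
    moreover have "integral {0..S c} f + integral {S c..S d} f = integral {0..S d} f"
      using c d Scd integrable_on_subinterval[OF assms(4), of 0 "S d"]
      by (intro Henstock_Kurzweil_Integration.integral_combine) auto
    moreover from this have "integral {S c..S d} f = G (S (snd (c, d))) - G (S (fst (c, d)))"
      by (simp add: G_def)
    ultimately show "has_proper_F_integral \<alpha> F h c d (G (S (snd (c, d))) - G (S (fst (c, d))))"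
      by simp
  next
    have "((\<lambda>d. G (S d)) \<longlongrightarrow> G (S t)) (at_left a)"
    proof (rule continuous_on_tendsto_compose[OF G])
      show "(S \<longlongrightarrow> S t) (at_left a)" using tendsto_staircase(2)[of a] a by simp
      have "\<forall>\<^sub>F d in at_left a. 0 < d \<and> d < a"
        using a(1) by (auto simp: eventually_at_left_field intro!: exI[of _ 0])
      then show "\<forall>\<^sub>F d in at_left a. S d \<in> {0..S t}"
        by eventually_elim (use staircase_nonneg staircase_mono[of _ a] a in auto)
    qed (use assms in auto)
    from filterlim_compose[OF this filterlim_snd]
    have 1: "((\<lambda>z. G (S (snd z))) \<longlongrightarrow> G (S t)) (at_right b \<times>\<^sub>F at_left a)" .
    have "((\<lambda>c. G (S c)) \<longlongrightarrow> G 0) (at_right b)"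
    proof (rule continuous_on_tendsto_compose[OF G])
      show "(S \<longlongrightarrow> 0) (at_right b)" using tendsto_staircase(1)[of b] b by simp
      have "\<forall>\<^sub>F c in at_right b. b < c \<and> c < a"
        using ba by (auto simp: eventually_at_right_field intro!: exI[of _ a])
      then show "\<forall>\<^sub>F c in at_right b. S c \<in> {0..S t}"
        by eventually_elim (use staircase_nonneg staircase_mono[of _ a] a b in auto)
    qed (use assms in auto)
    from filterlim_compose[OF this filterlim_fst]
    have 2: "((\<lambda>z. G (S (fst z))) \<longlongrightarrow> G 0) (at_right b \<times>\<^sub>F at_left a)" .
    show "((\<lambda>z. G (S (snd z)) - G (S (fst z))) \<longlongrightarrow> G (S t)) (at_right b \<times>\<^sub>F at_left a)"
      using tendsto_diff[OF 1 2] by (simp add: G_def)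
  qed
  moreover have "has_improper_F_integral \<alpha> F h 0 b 0"
  proof (cases "b = 0")
    case False
    have "F \<inter> {0<..<b} = {}" using not_in_F_level[of 0 _ b] b by auto
    then show ?thesis
      using has_improper_F_integral_snoc[OF has_improper_F_integral_refl _ improper_piece_gap, of 0 b h] False b
      by simp
  qed (simp add: has_improper_F_integral_refl)
  ultimately have *: "has_improper_F_integral \<alpha> F h 0 a (G (S t))"
    using has_improper_F_integral_snoc[of h 0 b 0 a "G (S t)"] ba by simp
  show ?thesis
  proof (cases "a = t")
    case False
    have "F \<inter> {a<..<t} = {}" using not_in_F_level[of a _ t] a by auto
    then show ?thesis
      using has_improper_F_integral_snoc[OF * _ improper_piece_gap, of t] False a
      by (simp add: G_def)
  qed (use * in \<open>simp add: G_def\<close>)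
qed

text \<open>Replaces the product filter by an increasing sequence of closed intervals, the form in
  which the convergence theorems apply.\<close>

lemma improper_piece_exhaustion:
  assumes "improper_piece h u v J" "0 \<le> u" "u < v"
  obtains c d :: "nat \<Rightarrow> real" and K :: "nat \<Rightarrow> real" where
    "\<And>k. S u \<le> S (c k)" "\<And>k. S (d k) \<le> S v" "\<And>k. S (c (Suc k)) \<le> S (c k)" "\<And>k. S (d k) \<le> S (d (Suc k))"
    "(\<lambda>k. S (c k)) \<longlonglongrightarrow> S u" "(\<lambda>k. S (d k)) \<longlonglongrightarrow> S v" "K \<longlonglongrightarrow> J"
    "\<And>k. ((\<lambda>s. h (upper_inv s)) has_integral K k) {S (c k)..S (d k)}"
proof -
  from assms(1) obtain \<Phi> where
    \<Phi>: "\<And>c d. u < c \<Longrightarrow> c < d \<Longrightarrow> d < v \<Longrightarrow> has_proper_F_integral \<alpha> F h c d (\<Phi> (c, d))"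
    and lim: "(\<Phi> \<longlongrightarrow> J) (at_right u \<times>\<^sub>F at_left v)"
    unfolding improper_piece_def by blast
  \<comment> \<open>The offset 3 makes 2 w k smaller than v - u from k = 0 on, so that u + w k < v -
    w k throughout.\<close>
  define w where "w = (\<lambda>k. (v - u) / (real k + 3))"
  have w: "0 < w k" "2 * w k < v - u" "w (Suc k) \<le> w k" for k
    using assms(3) add_strict_mono[OF assms(3), of "u * real k" "v * real k"]
      mult_right_mono[OF less_imp_le[OF assms(3)], of "real k"]
    by (auto simp: w_def field_simps)
  have w0: "w \<longlonglongrightarrow> 0" unfolding w_def by real_asymp
  have cl: "filterlim (\<lambda>k. u + w k) (at_right u) sequentially"
    unfolding filterlim_at using w(1) tendsto_add[OF tendsto_const w0, of u]
    by (auto intro!: always_eventually simp: less_imp_neq[symmetric])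
  have dl: "filterlim (\<lambda>k. v - w k) (at_left v) sequentially"
    unfolding filterlim_at using w(1) tendsto_diff[OF tendsto_const w0, of v]
    by (auto intro!: always_eventually simp: less_imp_neq[symmetric])
  show thesis
  proof (rule that[of "\<lambda>k. u + w k" "\<lambda>k. v - w k" "\<lambda>k. \<Phi> (u + w k, v - w k)"])
    fix k
    note wk = w[of k] w[of "Suc k"]
    show "S u \<le> S (u + w k)" "S (u + w (Suc k)) \<le> S (u + w k)" "S (v - w k) \<le> S v"
      "S (v - w k) \<le> S (v - w (Suc k))"
      using wk assms(2,3) by (auto intro!: staircase_mono)
    have "has_proper_F_integral \<alpha> F h (u + w k) (v - w k) (\<Phi> (u + w k, v - w k))"
      using wk by (intro \<Phi>) auto
    then show "((\<lambda>s. h (upper_inv s)) has_integral \<Phi> (u + w k, v - w k)) {S (u + w k)..S (v - w k)}"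
      by (rule has_proper_F_integral_imp) (use wk assms(2) in auto)
  next
    show "(\<lambda>k. S (u + w k)) \<longlonglongrightarrow> S u"
      by (rule filterlim_compose[OF tendsto_staircase(1) cl]) fact
    show "(\<lambda>k. S (v - w k)) \<longlonglongrightarrow> S v"
      by (rule filterlim_compose[OF tendsto_staircase(2) dl]) (use assms in auto)
    show "(\<lambda>k. \<Phi> (u + w k, v - w k)) \<longlonglongrightarrow> J"
      by (rule filterlim_compose[OF lim filterlim_Pair[OF cl dl]])
  qed
qed

lemma exhaustion_tendsto:
  fixes c d :: "nat \<Rightarrow> real" and f :: "real \<Rightarrow> real"
  assumes "c \<longlonglongrightarrow> a" "d \<longlonglongrightarrow> b" "s \<in> {a<..<b}"
  shows "(\<lambda>k. if s \<in> {c k..d k} then f s else 0) \<longlonglongrightarrow> f s"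
proof (rule tendsto_eventually)
  have "\<forall>\<^sub>F k in sequentially. c k < s" "\<forall>\<^sub>F k in sequentially. s < d k"
    using order_tendstoD(2)[OF assms(1)] order_tendstoD(1)[OF assms(2)] assms(3) by auto
  then show "\<forall>\<^sub>F k in sequentially. (if s \<in> {c k..d k} then f s else 0) = f s"
    by eventually_elim auto
qed

lemma nonneg_improper_piece_imp:
  assumes "improper_piece h u v J" "0 \<le> u" "u < v" "\<And>x. 0 \<le> h x"
  shows "(\<lambda>s. h (upper_inv s)) integrable_on {S u..S v}"
proof -
  let ?f = "\<lambda>s. h (upper_inv s)"
  obtain c d K where *: "\<And>k. S u \<le> S (c k)" "\<And>k. S (d k) \<le> S v" "\<And>k. S (c (Suc k)) \<le> S (c k)"
    "\<And>k. S (d k) \<le> S (d (Suc k))" "(\<lambda>k. S (c k)) \<longlonglongrightarrow> S u" "(\<lambda>k. S (d k)) \<longlonglongrightarrow> S v" "K \<longlonglongrightarrow> J"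
    "\<And>k. (?f has_integral K k) {S (c k)..S (d k)}"
    using improper_piece_exhaustion[OF assms(1-3)] by blast
  let ?g = "\<lambda>k s. if s \<in> {S (c k)..S (d k)} then ?f s else 0"
  have g: "(?g k has_integral K k) {S u..S v}" for k
    using *(1)[of k] *(2)[of k] *(8)[of k] by (subst has_integral_restrict) auto
  then have g': "(?g k has_integral K k) {S u<..<S v}" for k
    by (simp add: has_integral_Icc_iff_Ioo)
  \<comment> \<open>Monotone convergence: the truncations increase because h is nonnegative, and
    their integrals K k are bounded because they converge. The open interval is used since the
    exhaustion need not reach the end points.\<close>
  have "?f integrable_on {S u<..<S v} \<and> (\<lambda>k. integral {S u<..<S v} (?g k)) \<longlonglongrightarrow> integral {S u<..<S v} ?f"
  proof (rule monotone_convergence_increasing)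
    show "?g k integrable_on {S u<..<S v}" for k using g' by blast
    show "?g k s \<le> ?g (Suc k) s" for k s
      using *(3)[of k] *(4)[of k] assms(4) by auto
    show "(\<lambda>k. ?g k s) \<longlonglongrightarrow> ?f s" if "s \<in> {S u<..<S v}" for s
      using exhaustion_tendsto[OF *(5,6) that] .
    have "(\<lambda>k. integral {S u<..<S v} (?g k)) = K" using g' by (auto simp: integral_unique)
    then show "bounded (range (\<lambda>k. integral {S u<..<S v} (?g k)))"
      using *(7) by (simp add: convergent_imp_bounded)
  qed
  then show ?thesis by (simp add: integrable_on_open_interval_real)
qed

text \<open>Dominated convergence along the same exhaustion, with the absolute value as majorant,
  identifies the improper limit with the ordinary integral.\<close>

lemma improper_piece_imp:
  assumes "improper_piece h u v J" "0 \<le> u" "u < v"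
    and "(\<lambda>s. \<bar>h (upper_inv s)\<bar>) integrable_on {S u..S v}"
  shows "((\<lambda>s. h (upper_inv s)) has_integral J) {S u..S v}"
proof -
  let ?f = "\<lambda>s. h (upper_inv s)"
  obtain c d K where *: "\<And>k. S u \<le> S (c k)" "\<And>k. S (d k) \<le> S v" "\<And>k. S (c (Suc k)) \<le> S (c k)"
    "\<And>k. S (d k) \<le> S (d (Suc k))" "(\<lambda>k. S (c k)) \<longlonglongrightarrow> S u" "(\<lambda>k. S (d k)) \<longlonglongrightarrow> S v" "K \<longlonglongrightarrow> J"
    "\<And>k. (?f has_integral K k) {S (c k)..S (d k)}"
    using improper_piece_exhaustion[OF assms(1-3)] by blast
  let ?g = "\<lambda>k s. if s \<in> {S (c k)..S (d k)} then ?f s else 0"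
  have g: "(?g k has_integral K k) {S u..S v}" for k
    using *(1)[of k] *(2)[of k] *(8)[of k] by (subst has_integral_restrict) auto
  then have g': "(?g k has_integral K k) {S u<..<S v}" for k
    by (simp add: has_integral_Icc_iff_Ioo)
  have "(?f has_integral J) {S u<..<S v}"
  proof (rule has_integral_dominated_convergence[OF g'])
    show "(\<lambda>s. \<bar>?f s\<bar>) integrable_on {S u<..<S v}"
      using assms(4) by (simp add: integrable_on_open_interval_real)
    show "\<forall>s\<in>{S u<..<S v}. (\<lambda>k. ?g k s) \<longlonglongrightarrow> ?f s"
      using exhaustion_tendsto[OF *(5,6), where f = ?f] by (intro ballI)
  qed (use * in auto)
  then show ?thesis by (simp add: has_integral_Icc_iff_Ioo)
qed

lemma subdivision_integral:
  fixes f :: "real \<Rightarrow> real"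
  assumes "subdivision a b n x" "0 \<le> a" "\<And>i. i < n \<Longrightarrow> (f has_integral J i) {S (x i)..S (x (Suc i))}"
  shows "(f has_integral (\<Sum>i<n. J i)) {S a..S b}"
  using assms(1,3)
proof (induction n arbitrary: b)
  case 0
  then show ?case by (auto simp: subdivision_0 intro: has_integral_refl)
next
  case (Suc n)
  then have sub: "subdivision a (x n) n x" "x n < b" "x (Suc n) = b" by (auto simp: subdivision_Suc)
  have "(f has_integral (\<Sum>i<n. J i)) {S a..S (x n)}" by (rule Suc.IH[OF sub(1)]) (use Suc.prems(2) in simp)
  moreover have "(f has_integral J n) {S (x n)..S b}" using Suc.prems(2)[of n] sub by simp
  moreover have "S a \<le> S (x n)" "S (x n) \<le> S b"
    using subdivision_imp_le[OF sub(1)] sub assms(2) by (auto intro!: staircase_mono)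
  ultimately show ?case using has_integral_combine[of "S a" "S (x n)" "S b" f] by simp
qed

lemma has_F_integral_nonneg_imp:
  assumes "has_F_integral \<alpha> F h a b I" "0 \<le> a" "\<And>x. 0 \<le> h x"
  shows "(\<lambda>s. h (upper_inv s)) integrable_on {S a..S b}"
  using assms(1) unfolding has_F_integral_def
proof
  assume "has_proper_F_integral \<alpha> F h a b I"
  from has_proper_F_integral_imp[OF this assms(2)] show ?thesis by blast
next
  assume "has_improper_F_integral \<alpha> F h a b I"
  then obtain n x J where *: "subdivision a b n x" "\<And>i. i < n \<Longrightarrow> improper_piece h (x i) (x (Suc i)) (J i)"
    unfolding has_improper_F_integral_iff by blast
  have "(\<lambda>s. h (upper_inv s)) integrable_on {S (x i)..S (x (Suc i))}" if "i < n" for i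
  proof (rule nonneg_improper_piece_imp[OF *(2)[OF that] _ _ assms(3)])
    show "0 \<le> x i" using subdivision_bounds[OF *(1), of i] that assms(2) by auto
    show "x i < x (Suc i)" using *(1) that by (simp add: subdivision_def)
  qed
  from subdivision_integral[OF *(1) assms(2) integrable_integral[OF this]] show ?thesis by blast
qed

lemma has_F_integral_imp:
  assumes "has_F_integral \<alpha> F h a b I" "0 \<le> a" "(\<lambda>s. \<bar>h (upper_inv s)\<bar>) integrable_on {S a..S b}"
  shows "((\<lambda>s. h (upper_inv s)) has_integral I) {S a..S b}"
  using assms(1) unfolding has_F_integral_def
proof
  assume "has_proper_F_integral \<alpha> F h a b I"
  from has_proper_F_integral_imp[OF this assms(2)] show ?thesis .
next
  assume "has_improper_F_integral \<alpha> F h a b I"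
  then obtain n x J where *: "subdivision a b n x" "\<And>i. i < n \<Longrightarrow> improper_piece h (x i) (x (Suc i)) (J i)"
    "I = (\<Sum>i<n. J i)"
    unfolding has_improper_F_integral_iff by blast
  have "((\<lambda>s. h (upper_inv s)) has_integral J i) {S (x i)..S (x (Suc i))}" if i: "i < n" for i
  proof (rule improper_piece_imp[OF *(2)[OF i]])
    have b: "a \<le> x i" "x (Suc i) \<le> b" "x i < x (Suc i)"
      using subdivision_bounds[OF *(1), of i] subdivision_bounds[OF *(1), of "Suc i"] i *(1)
      by (auto simp: subdivision_def)
    then show "0 \<le> x i" "x i < x (Suc i)" using assms(2) by auto
    show "(\<lambda>s. \<bar>h (upper_inv s)\<bar>) integrable_on {S (x i)..S (x (Suc i))}"
      by (rule integrable_on_subinterval[OF assms(3)]) (use b assms(2) in \<open>auto intro: order_trans staircase_mono\<close>)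
  qed
  from subdivision_integral[OF *(1) assms(2) this] show ?thesis using *(3) by simp
qed

text \<open>The absolute value is transferred first and then dominates h. Every F-integral of h,
  proper or improper and with any choice of singular points, therefore has the same value, so the
  definite description in \<open>F_integral\<close> is unambiguous.\<close>

lemma absolutely_F_integrable_imp:
  assumes "absolutely_F_integrable \<alpha> F h a b" "0 \<le> a"
  shows "(\<lambda>s. h (upper_inv s)) absolutely_integrable_on {S a..S b}"
    and "has_F_integral \<alpha> F h a b I \<Longrightarrow> ((\<lambda>s. h (upper_inv s)) has_integral I) {S a..S b}"
    and "F_integral \<alpha> F h a b = integral {S a..S b} (\<lambda>s. h (upper_inv s))"
proof -
  from assms(1) obtain I I' where I: "has_F_integral \<alpha> F h a b I" "has_F_integral \<alpha> F (\<lambda>y. \<bar>h y\<bar>) a b I'"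
    unfolding absolutely_F_integrable_def by blast
  have abs: "(\<lambda>s. \<bar>h (upper_inv s)\<bar>) integrable_on {S a..S b}"
    using has_F_integral_nonneg_imp[OF I(2) assms(2)] by simp
  note hI = has_F_integral_imp[OF _ assms(2) abs]
  show "has_F_integral \<alpha> F h a b I \<Longrightarrow> ((\<lambda>s. h (upper_inv s)) has_integral I) {S a..S b}" for I
    by (rule hI)
  show "(\<lambda>s. h (upper_inv s)) absolutely_integrable_on {S a..S b}"
    by (rule absolutely_integrable_onI) (use hI[OF I(1)] abs in auto)
  show "F_integral \<alpha> F h a b = integral {S a..S b} (\<lambda>s. h (upper_inv s))"
    unfolding F_integral_def by (rule the_equality) (use hI I(1) integral_unique in metis)+
qed

end

subsection \<open>Uniqueness for the classical Caputo equation\<close>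

text \<open>If \<open>g b < g a\<close>, a value outside the countable set \<open>g ` X\<close> is attained for the last time at a
  point where the derivative exists and is positive.\<close>

lemma mono_of_countable_exceptions:
  fixes g :: "real \<Rightarrow> real"
  assumes "a \<le> b" "continuous_on {a..b} g" "countable X"
    and deriv: "\<And>x. a < x \<Longrightarrow> x < b \<Longrightarrow> x \<notin> X \<Longrightarrow> \<exists>D>0. (g has_real_derivative D) (at x)"
  shows "g a \<le> g b"
proof (rule ccontr)
  assume "\<not> g a \<le> g b"
  then have lt: "g b < g a" by simp
  have "uncountable ({g b<..<g a} - g ` X)"
    using lt assms(3) by (intro uncountable_minus_countable uncountable_open_interval[THEN iffD2]) auto
  then obtain y where y: "g b < y" "y < g a" "y \<notin> g ` X"
    by (metis DiffD1 DiffD2 countable_empty equals0I greaterThanLessThan_iff)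
  define T where "T = {x \<in> {a..b}. y \<le> g x}"
  have "closed T"
  proof -
    have "T = {a..b} \<inter> g -` {y..}" by (auto simp: T_def)
    then show ?thesis using continuous_closed_preimage[OF assms(2)] by simp
  qed
  moreover have bdd: "bdd_above T" by (rule bdd_aboveI[of _ b]) (auto simp: T_def)
  moreover have "a \<in> T" using assms(1) y by (simp add: T_def)
  ultimately have c: "Sup T \<in> T" by (intro closed_contains_Sup) auto
  define c where "c = Sup T"
  have cT: "a \<le> c" "c \<le> b" "y \<le> g c" using c by (auto simp: c_def T_def)
  have right: "g x < y" if "c < x" "x \<le> b" for x
  proof (rule ccontr)
    assume "\<not> g x < y"
    then have "x \<in> T" using that cT by (simp add: T_def)
    from cSup_upper[OF this bdd] that show False by (simp add: c_def)
  qed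
  have cb: "c < b" using cT y by (cases "c = b") auto
  have "\<exists>x\<ge>c. x \<le> b \<and> g x = y"
    using cT y cb by (intro IVT2' continuous_on_subset[OF assms(2)]) auto
  then have gc: "g c = y" using right by (metis less_irrefl order_le_less)
  then have "a < c" "c \<notin> X" using y cT by (auto simp: order_le_less)
  from deriv[OF this(1) cb this(2)] obtain D where D: "D > 0" "(g has_real_derivative D) (at c)" by blast
  \<comment> \<open>A positive derivative pushes g above y immediately after c, although g is below
    y everywhere to the right of c.\<close>
  from DERIV_pos_inc_right[OF D(2,1)] obtain d where
    d: "d > 0" "\<And>h. 0 < h \<Longrightarrow> h < d \<Longrightarrow> g c < g (c + h)" by blast
  define h where "h = min (d/2) (b - c)"
  have "0 < h" "h < d" "c + h \<le> b" using d(1) cb by (auto simp: h_def)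
  then show False using d(2)[of h] right[of "c + h"] gc by auto
qed

text \<open>Adding k x with small k > 0 turns the zero derivative into a positive one; letting the
  total tilt k (b - a) tend to 0, for g and for its negative, gives both inequalities.\<close>

lemma constant_of_countable_exceptions:
  fixes g :: "real \<Rightarrow> real"
  assumes "a \<le> b" "continuous_on {a..b} g" "countable X"
    and deriv: "\<And>x. a < x \<Longrightarrow> x < b \<Longrightarrow> x \<notin> X \<Longrightarrow> (g has_real_derivative 0) (at x)"
  shows "g a = g b"
proof -
  have *: "h a \<le> h b"
    if cont: "continuous_on {a..b} h" and der: "\<And>x. a < x \<Longrightarrow> x < b \<Longrightarrow> x \<notin> X \<Longrightarrow> (h has_real_derivative 0) (at x)"
    for h :: "real \<Rightarrow> real"
  proof (rule field_le_epsilon)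
    fix e :: real assume e: "0 < e"
    define k where "k = e / (b - a + 1)"
    have k: "0 < k" "k * (b - a) \<le> e" using e assms(1) by (auto simp: k_def field_simps)
    have "h a + k * a \<le> h b + k * b"
    proof (rule mono_of_countable_exceptions[OF assms(1) _ assms(3), where g = "\<lambda>x. h x + k * x"])
      show "continuous_on {a..b} (\<lambda>x. h x + k * x)" by (intro continuous_intros cont)
      show "\<exists>D>0. ((\<lambda>x. h x + k * x) has_real_derivative D) (at x)" if "a < x" "x < b" "x \<notin> X" for x
        using k(1) by (intro exI[of _ k]) (auto intro!: derivative_eq_intros der[OF that])
    qed
    then show "h a \<le> h b + e" using k by (simp add: algebra_simps)
  qed
  have "g a \<le> g b" by (rule *) (use assms in auto)
  moreover have "- g a \<le> - g b"
    by (rule *) (use assms in \<open>auto intro!: continuous_intros derivative_eq_intros\<close>)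
  ultimately show ?thesis by simp
qed

section \<open>Beta integrals and Abel inversion\<close>

lemma has_integral_Beta_interval:
  fixes x y a r :: real
  assumes "0 < x" "0 < y" "a < r"
  shows "((\<lambda>s. (r - s) powr (x - 1) * (s - a) powr (y - 1)) has_integral
    Beta x y * (r - a) powr (x + y - 1)) {a..r}"
proof -
  \<comment> \<open>Reciprocal length of the interval: the substitution is s -> m (s - a), which
    carries [a, r] to [0, 1].\<close>
  define m where "m = 1 / (r - a)"
  have m: "0 < m" "m * (r - a) = 1" using assms by (auto simp: m_def)
  have "((\<lambda>t. t powr (y - 1) * (1 - t) powr (x - 1)) has_integral Beta y x) (cbox 0 1)"
    using has_integral_Beta_real[OF assms(2,1)] by simp
  from has_integral_affinity'[OF this m(1), of "- a * m"]
  have "((\<lambda>s. (m * s - a * m) powr (y - 1) * (1 - (m * s - a * m)) powr (x - 1)) has_integral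
    Beta y x / m) {a * m / m..(1 + a * m) / m}"
    by (simp add: field_simps)
  also have "{a * m / m..(1 + a * m) / m} = {a..r}"
    using m by (simp add: field_simps m_def)
  finally have "((\<lambda>s. (m * s - a * m) powr (y - 1) * (1 - (m * s - a * m)) powr (x - 1)) has_integral
    Beta y x / m) {a..r}" .
  from has_integral_mult_right[OF this, of "(r - a) powr (x + y - 2)"]
  have I1: "((\<lambda>s. (r - a) powr (x + y - 2) * ((m * s - a * m) powr (y - 1) * (1 - (m * s - a * m)) powr (x - 1)))
     has_integral (r - a) powr (x + y - 2) * (Beta y x / m)) {a..r}" .
  have "(r - a) powr (x + y - 1) = (r - a) powr (x + y - 2) * (r - a)"
    using assms powr_add[of "r - a" "x + y - 2" 1] by simp
  then have I2: "(r - a) powr (x + y - 2) * (Beta y x / m) = Beta x y * (r - a) powr (x + y - 1)"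
    using Beta_commute[of x y] by (simp add: m_def)
  have I3: "(r - a) powr (x + y - 2) * ((m * s - a * m) powr (y - 1) * (1 - (m * s - a * m)) powr (x - 1))
      = (r - s) powr (x - 1) * (s - a) powr (y - 1)" if "s \<in> {a..r}" for s
  proof -
    have 1: "m * s - a * m = (s - a) / (r - a)" by (simp add: m_def diff_divide_distrib)
    have "(r - s) / (r - a) = (r - a) / (r - a) - (s - a) / (r - a)"
      unfolding diff_divide_distrib[symmetric] by simp
    then have 2: "1 - (m * s - a * m) = (r - s) / (r - a)" using assms 1 by simp
    have 3: "(r - a) powr (x + y - 2) = (r - a) powr (x - 1) * (r - a) powr (y - 1)"
      by (simp flip: powr_add add: algebra_simps)
    show ?thesis
      unfolding 2 unfolding 1 3 using that assms by (simp add: powr_divide)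
  qed
  show ?thesis by (rule has_integral_eq[OF I3 I1[unfolded I2]])
qed

lemma Beta_pos: "0 < x \<Longrightarrow> 0 < y \<Longrightarrow> 0 < Beta x (y::real)"
  by (simp add: Beta_def)

text \<open>Fubini and termwise integration are used for Bochner integrals; for nonnegative
  functions the gauge integral carries over with its value.\<close>

lemma has_bochner_integral_of_nonneg_has_integral:
  fixes f :: "real \<Rightarrow> real"
  assumes "f \<in> borel_measurable borel" "\<And>x. 0 \<le> f x" "(f has_integral I) UNIV"
  shows "has_bochner_integral lborel f I"
proof (rule has_bochner_integral_nn_integral)
  show "0 \<le> I" using has_integral_nonneg[OF assms(3)] assms(2) by blast
  show "(\<integral>\<^sup>+x. ennreal (f x) \<partial>lborel) = ennreal I"
    by (rule nn_integral_has_integral_lborel[OF assms])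
qed (use assms in auto)

text \<open>Fubini on the triangle 0 \<le> t \<le> s \<le> r. The inner integral of
  \<open>(r - s) powr (\<beta> - 1) * (s - t) powr (- \<beta>)\<close> over [t, r] is the same Beta
  value for every t < r, because the exponents add up to -1.\<close>

lemma abel_convolution:
  fixes u v :: "real \<Rightarrow> real"
  assumes \<beta>: "0 < \<beta>" "\<beta> < 1" and r: "0 < r" and v: "v absolutely_integrable_on {0..r}"
    and ker: "\<And>s. 0 < s \<Longrightarrow> s \<le> r \<Longrightarrow> ((\<lambda>t. (s - t) powr (- \<beta>) * v t) has_integral u s) {0..s}"
  shows "((\<lambda>s. (r - s) powr (\<beta> - 1) * u s) has_integral Beta \<beta> (1 - \<beta>) * integral {0..r} v) {0..r}"
proof -
  let ?B = "Beta \<beta> (1 - \<beta>)"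
  define w where "w = (\<lambda>t. if t \<in> {0..r} then v t else 0)"
  have w_eq: "w = (\<lambda>t. indicator {0..r} t *\<^sub>R v t)" by (auto simp: w_def)
  have w: "integrable lebesgue w" using v unfolding set_integrable_def w_eq .
  \<comment> \<open>v is only Lebesgue measurable, whereas Fubini is applied to the product of Borel
    measures; hence the passage to a Borel function equal to v almost everywhere on [0, r].\<close>
  then obtain w' where w'_meas[measurable]: "w' \<in> borel_measurable lborel" and ae: "AE t in lborel. w t = w' t"
    using completion_ex_borel_measurable_real[of w lborel] by auto
  have "integrable lebesgue w'"
    using w ae by (subst integrable_cong_AE[of _ _ w]) (auto intro: AE_completion measurable_completion)
  then have w'_int: "integrable lborel w'" using integrable_completion[of w' lborel] by simp
  have "(w' has_integral integral\<^sup>L lborel w') UNIV"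
    by (rule has_integral_integral_lborel[OF w'_int])
  then have "(w has_integral integral\<^sup>L lborel w') UNIV"
    using has_integral_AE[of UNIV w w'] ae by simp
  then have w'_integral: "integral\<^sup>L lborel w' = integral {0..r} v"
    unfolding w_def has_integral_restrict_UNIV by (simp add: integral_unique)
  define H where "H = (\<lambda>t s. if 0 \<le> t \<and> t \<le> s \<and> s \<le> r
    then (r - s) powr (\<beta> - 1) * (s - t) powr (- \<beta>) * w' t else 0)"
  have H_meas[measurable]: "(\<lambda>z. H (fst z) (snd z)) \<in> borel_measurable (lborel \<Otimes>\<^sub>M lborel)"
    unfolding H_def by measurable
  have inner: "has_bochner_integral lborel (H t) (if 0 \<le> t \<and> t < r then ?B * w' t else 0)"
    "has_bochner_integral lborel (\<lambda>s. norm (H t s)) (if 0 \<le> t \<and> t < r then ?B * norm (w' t) else 0)" for t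
  proof -
    define k where "k = (\<lambda>s. if s \<in> {t..r} then (r - s) powr (\<beta> - 1) * (s - t) powr (- \<beta>) else 0)"
    have "has_bochner_integral lborel k ?B" if "t < r"
    proof (rule has_bochner_integral_of_nonneg_has_integral)
      show "(k has_integral ?B) UNIV"
        using has_integral_Beta_interval[of \<beta> "1 - \<beta>" t r] \<beta> that
        unfolding k_def has_integral_restrict_UNIV by simp
    qed (auto simp: k_def)
    then have k: "has_bochner_integral lborel (\<lambda>s. k s * c) (?B * c)" if "t < r" for c
      using that by (intro has_bochner_integral_mult_left) auto
    have "H t = (\<lambda>s. k s * w' t)" "(\<lambda>s. norm (H t s)) = (\<lambda>s. k s * norm (w' t))" if "0 \<le> t"
      using that by (auto simp: H_def k_def abs_mult)
    moreover have "H t = (\<lambda>_. 0)" if "\<not> (0 \<le> t \<and> t < r)"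
      using that by (auto simp: H_def fun_eq_iff)
    ultimately show "has_bochner_integral lborel (H t) (if 0 \<le> t \<and> t < r then ?B * w' t else 0)"
      "has_bochner_integral lborel (\<lambda>s. norm (H t s)) (if 0 \<le> t \<and> t < r then ?B * norm (w' t) else 0)"
      using k by (auto simp: has_bochner_integral_zero)
  qed
  have ae': "AE t in lborel. w' t = (if 0 \<le> t \<and> t < r then w' t else 0)"
  proof -
    have "AE t in lborel. t \<noteq> r" by (rule AE_lborel_singleton)
    with ae show ?thesis by eventually_elim (auto simp: w_def)
  qed
  have H_int: "integrable (lborel \<Otimes>\<^sub>M lborel) (case_prod H)"
  proof (rule lborel_pair.Fubini_integrable)
    have 1: "integrable lborel (\<lambda>t. ?B * norm (w' t))" using w'_int by simp
    have 2: "AE t in lborel. ?B * norm (w' t) = integral\<^sup>L lborel (\<lambda>s. norm (H t s))"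
      using ae'
    proof eventually_elim
      case (elim t)
      then show ?case
        unfolding has_bochner_integral_integral_eq[OF inner(2)] by (auto split: if_splits)
    qed
    have "(\<lambda>t. integral\<^sup>L lborel (\<lambda>s. norm (H t s))) \<in> borel_measurable lborel"
      using H_meas by (intro lborel.borel_measurable_lebesgue_integral) (simp add: case_prod_beta')
    from integrable_cong_AE_imp[OF 1 this 2]
    show "integrable lborel (\<lambda>t. integral\<^sup>L lborel (\<lambda>s. norm (case_prod H (t, s))))" by simp
    show "AE t in lborel. integrable lborel (\<lambda>s. case_prod H (t, s))"
      using inner(1) by (auto simp: has_bochner_integral_iff)
  qed (simp add: case_prod_beta')
  have "(\<integral>s. (\<integral>t. H t s \<partial>lborel) \<partial>lborel) = (\<integral>t. (\<integral>s. H t s \<partial>lborel) \<partial>lborel)"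
    by (rule lborel_pair.Fubini_integral[OF H_int])
  also have "\<dots> = (\<integral>t. ?B * w' t \<partial>lborel)"
  proof (rule integral_cong_AE)
    show "AE t in lborel. (\<integral>s. H t s \<partial>lborel) = ?B * w' t"
      using ae'
    proof eventually_elim
      case (elim t)
      then show ?case
        unfolding has_bochner_integral_integral_eq[OF inner(1)] by (auto split: if_splits)
    qed
  qed auto
  also have "\<dots> = ?B * integral {0..r} v" by (simp add: w'_integral)
  finally have total: "(\<integral>s. (\<integral>t. H t s \<partial>lborel) \<partial>lborel) = ?B * integral {0..r} v" .
  have "integrable lborel (\<lambda>s. \<integral>t. H t s \<partial>lborel)" by (rule lborel_pair.integrable_snd[OF H_int])
  from has_integral_integral_lborel[OF this]
  have 1: "((\<lambda>s. \<integral>t. H t s \<partial>lborel) has_integral ?B * integral {0..r} v) UNIV" unfolding total .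
  \<comment> \<open>For almost every s the section of H is integrable, and its integral is
    identified through \<open>ker\<close>. The point s = 0 is removed because \<open>ker\<close> is
    available only for positive s.\<close>
  have "AE s in lborel. (\<integral>t. H t s \<partial>lborel) = (if s \<in> {0..r} then (r - s) powr (\<beta> - 1) * u s else 0)"
    using lborel_pair.AE_integrable_snd[OF H_int] AE_lborel_singleton[of 0]
  proof eventually_elim
    case (elim s)
    show ?case
    proof (cases "s \<in> {0..r}")
      case True
      with elim have s: "0 < s" "s \<le> r" by auto
      let ?k = "\<lambda>t. if t \<in> {0..s} then (r - s) powr (\<beta> - 1) * ((s - t) powr (- \<beta>) * v t) else 0"
      have "(?k has_integral (r - s) powr (\<beta> - 1) * u s) UNIV"
        unfolding has_integral_restrict_UNIV by (intro has_integral_mult_right ker s)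
      moreover have "AE t in lborel. ?k t = H t s"
        using ae by eventually_elim (use s in \<open>auto simp: H_def w_def\<close>)
      ultimately have "((\<lambda>t. H t s) has_integral (r - s) powr (\<beta> - 1) * u s) UNIV"
        using has_integral_AE[of UNIV ?k "\<lambda>t. H t s"] by simp
      with has_integral_integral_lborel[OF elim(1)] show ?thesis
        using True has_integral_unique by auto
    next
      case False
      then have "(\<lambda>t. H t s) = (\<lambda>_. 0)" by (auto simp: H_def fun_eq_iff)
      then show ?thesis using False by auto
    qed
  qed
  with 1 have "((\<lambda>s. if s \<in> {0..r} then (r - s) powr (\<beta> - 1) * u s else 0) has_integral ?B * integral {0..r} v) UNIV"
    using has_integral_AE[of UNIV "\<lambda>s. \<integral>t. H t s \<partial>lborel"
        "\<lambda>s. if s \<in> {0..r} then (r - s) powr (\<beta> - 1) * u s else 0"] by simp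
  then show ?thesis unfolding has_integral_restrict_UNIV .
qed

text \<open>If u vanishes up to R, only the kernel on [R, x] matters, and its integral depends on x
  - R alone. On an interval of length \<epsilon> the maximum of |u| is thus at most a fixed factor
  below 1 times itself.\<close>

lemma weakly_singular_volterra_zero:
  fixes u :: "real \<Rightarrow> real"
  assumes \<beta>: "0 < \<beta>" and u: "continuous_on {0..} u" and u0: "u 0 = 0"
    and eq: "\<And>r. 0 < r \<Longrightarrow> ((\<lambda>s. K * ((r - s) powr (\<beta> - 1) * u s)) has_integral u r) {0..r}"
    and "0 \<le> r"
  shows "u r = 0"
proof -
  define b where "b = \<bar>K\<bar> * Beta \<beta> 1"
  have b: "0 \<le> b" using Beta_pos[of \<beta> 1] \<beta> by (simp add: b_def)
  \<comment> \<open>Chosen so that \<open>\<epsilon> powr \<beta>\<close> equals 1 / (2 (b + 1)),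
    which makes the contraction factor less than 1 independently of R.\<close>
  define \<epsilon> where "\<epsilon> = (1 / (2 * (b + 1))) powr (1 / \<beta>)"
  have \<epsilon>: "0 < \<epsilon>" "b * \<epsilon> powr \<beta> < 1"
    using b \<beta> by (auto simp: \<epsilon>_def powr_powr field_simps)
  have step: "u r = 0" if R: "0 \<le> R" "\<And>s. 0 \<le> s \<Longrightarrow> s \<le> R \<Longrightarrow> u s = 0" and r: "R \<le> r" "r \<le> R + \<epsilon>" for R r
  proof -
    have "compact {R..R + \<epsilon>}" "{R..R + \<epsilon>} \<noteq> {}" "continuous_on {R..R + \<epsilon>} (\<lambda>s. \<bar>u s\<bar>)"
      using \<epsilon>(1) R(1) by (auto intro!: continuous_intros continuous_on_subset[OF u])
    from continuous_attains_sup[OF this] obtain x where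
      x: "x \<in> {R..R + \<epsilon>}" "\<And>s. s \<in> {R..R + \<epsilon>} \<Longrightarrow> \<bar>u s\<bar> \<le> \<bar>u x\<bar>" by blast
    have "u x = 0"
    proof (cases "x = R")
      case True
      then show ?thesis using R by simp
    next
      case False
      with x R have xR: "R < x" "0 < x" by auto
      let ?g = "\<lambda>s. \<bar>K\<bar> * \<bar>u x\<bar> * (if s \<in> {R..x} then (x - s) powr (\<beta> - 1) else 0)"
      have X: "((\<lambda>s. (x - s) powr (\<beta> - 1) * (s - R) powr (1 - 1)) has_integral
          Beta \<beta> 1 * (x - R) powr (\<beta> + 1 - 1)) {R..x}"
        using xR \<beta> by (intro has_integral_Beta_interval) auto
      \<comment> \<open>The factor \<open>(s - R) powr 0\<close> is 1 except at s = R, where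
        \<open>0 powr 0\<close> is 0; one point is harmless.\<close>
      have "((\<lambda>s. (x - s) powr (\<beta> - 1)) has_integral Beta \<beta> 1 * (x - R) powr (\<beta> + 1 - 1)) {R..x}"
        by (rule has_integral_spike_finite[of "{R}", OF _ _ X]) auto
      then have "((\<lambda>s. if s \<in> {R..x} then (x - s) powr (\<beta> - 1) else 0)
          has_integral Beta \<beta> 1 * (x - R) powr \<beta>) {0..x}"
        using R by (subst has_integral_restrict) simp_all
      then have g: "(?g has_integral \<bar>K\<bar> * \<bar>u x\<bar> * (Beta \<beta> 1 * (x - R) powr \<beta>)) {0..x}"
        by (rule has_integral_mult_right)
      have "norm (integral {0..x} (\<lambda>s. K * ((x - s) powr (\<beta> - 1) * u s))) \<le> integral {0..x} ?g"
      proof (rule Henstock_Kurzweil_Integration.integral_norm_bound_integral)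
        fix s assume s: "s \<in> {0..x}"
        show "norm (K * ((x - s) powr (\<beta> - 1) * u s)) \<le> ?g s"
        proof (cases "R \<le> s")
          case True
          then have "(x - s) powr (\<beta> - 1) * \<bar>u s\<bar> \<le> (x - s) powr (\<beta> - 1) * \<bar>u x\<bar>"
            using x(2)[of s] s x(1) by (intro mult_left_mono) auto
          then have "\<bar>K\<bar> * ((x - s) powr (\<beta> - 1) * \<bar>u s\<bar>) \<le> \<bar>K\<bar> * ((x - s) powr (\<beta> - 1) * \<bar>u x\<bar>)"
            by (rule mult_left_mono) (rule abs_ge_zero)
          moreover have "norm (K * ((x - s) powr (\<beta> - 1) * u s)) = \<bar>K\<bar> * ((x - s) powr (\<beta> - 1) * \<bar>u s\<bar>)"
            by (simp add: abs_mult)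
          moreover have "?g s = \<bar>K\<bar> * ((x - s) powr (\<beta> - 1) * \<bar>u x\<bar>)"
            using True s by simp
          ultimately show ?thesis by linarith
        qed (use s R(2)[of s] in simp)
      qed (use g eq[OF xR(2)] in auto)
      then have "\<bar>u x\<bar> \<le> \<bar>K\<bar> * \<bar>u x\<bar> * (Beta \<beta> 1 * (x - R) powr \<beta>)"
        unfolding integral_unique[OF g] integral_unique[OF eq[OF xR(2)]] real_norm_def .
      also have "\<dots> = \<bar>u x\<bar> * (b * (x - R) powr \<beta>)" by (simp add: b_def)
      also have "\<dots> \<le> \<bar>u x\<bar> * (b * \<epsilon> powr \<beta>)"
        using b x(1) \<beta> by (intro mult_left_mono powr_mono2) auto
      finally have "\<bar>u x\<bar> * (1 - b * \<epsilon> powr \<beta>) \<le> 0" by (simp add: algebra_simps)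
      then show ?thesis using \<epsilon>(2) by (simp add: mult_le_0_iff)
    qed
    then show ?thesis using x(2)[of r] r by auto
  qed
  have "\<forall>s. 0 \<le> s \<longrightarrow> s \<le> real n * \<epsilon> \<longrightarrow> u s = 0" for n
  proof (induction n)
    case 0
    then show ?case using u0 by auto
  next
    case (Suc n)
    show ?case
    proof (intro allI impI)
      fix s assume s: "0 \<le> s" "s \<le> real (Suc n) * \<epsilon>"
      show "u s = 0"
      proof (cases "s \<le> real n * \<epsilon>")
        case False
        then show ?thesis
          using step[of "real n * \<epsilon>" s] Suc s \<epsilon>(1) by (auto simp: algebra_simps)
      qed (use Suc s in blast)
    qed
  qed
  moreover obtain n where "r / \<epsilon> < real n" using reals_Archimedean2 by blast
  then have "r \<le> real n * \<epsilon>" using \<epsilon>(1) by (simp add: field_simps)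
  ultimately show ?thesis using \<open>0 \<le> r\<close> by blast
qed

lemma caputo_equation_zero:
  fixes u v :: "real \<Rightarrow> real"
  assumes \<beta>: "0 < \<beta>" "\<beta> < 1" and u: "continuous_on {0..} u" and u0: "u 0 = 0"
    and v: "\<And>r. 0 < r \<Longrightarrow> v absolutely_integrable_on {0..r}"
      "\<And>r. 0 < r \<Longrightarrow> (v has_integral u r) {0..r}"
    and ker: "\<And>s. 0 < s \<Longrightarrow> ((\<lambda>t. (s - t) powr (- \<beta>) * v t) has_integral C * u s) {0..s}"
    and "0 \<le> r"
  shows "u r = 0"
proof (rule weakly_singular_volterra_zero[OF \<beta>(1) u u0 _ \<open>0 \<le> r\<close>])
  fix r :: real assume r: "0 < r"
  let ?B = "Beta \<beta> (1 - \<beta>)"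
  have B: "0 < ?B" using \<beta> by (simp add: Beta_pos)
  have "((\<lambda>s. (r - s) powr (\<beta> - 1) * (C * u s)) has_integral ?B * integral {0..r} v) {0..r}"
    using \<beta> r v(1)[OF r] ker by (intro abel_convolution) auto
  from has_integral_mult_right[OF this, of "1 / ?B"]
  show "((\<lambda>s. C / ?B * ((r - s) powr (\<beta> - 1) * u s)) has_integral u r) {0..r}"
    using B integral_unique[OF v(2)[OF r]] by (simp add: mult_ac)
qed

subsection \<open>The Mittag-Leffler function\<close>

lemma Gamma_plus1_pos:
  assumes "0 < (x::real)"
  shows "Gamma (x + 1) = x * Gamma x"
proof (rule Gamma_plus1)
  show "x \<notin> \<int>\<^sub>\<le>\<^sub>0"
  proof
    assume "x \<in> \<int>\<^sub>\<le>\<^sub>0"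
    then have "x \<le> 0" by (elim nonpos_Ints_cases) simp
    with assms show False by simp
  qed
qed

text \<open>Log-convexity of \<open>\<Gamma>\<close> at \<open>x - 1 < x < x + \<beta>\<close>.\<close>

lemma Gamma_ratio_ge:
  assumes "0 < \<beta>" "\<beta> < 1" "1 < (x::real)"
  shows "Gamma x * (x - 1) powr \<beta> \<le> Gamma (x + \<beta>)"
proof -
  have G: "0 < Gamma x" "0 < Gamma (x - 1)" "0 < Gamma (x + \<beta>)"
    using assms by (auto intro!: Gamma_real_pos)
  let ?f = "ln \<circ> (Gamma :: real \<Rightarrow> real)"
  \<comment> \<open>The weight for which x is the convex combination of x + \<beta> and x - 1.
    Multiplying by 1 + \<beta> and using \<Gamma>(x) = (x - 1) \<Gamma>(x - 1) then leaves the
    claimed inequality in logarithms.\<close>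
  define t where "t = \<beta> / (1 + \<beta>)"
  have t: "0 \<le> t" "t \<le> 1" "1 - t = 1 / (1 + \<beta>)"
    using assms by (auto simp: t_def field_simps)
  have "(1 - t) * (x + \<beta>) + t * (x - 1) = x * (1 + \<beta>) / (1 + \<beta>)"
    unfolding t(3) unfolding t_def by (simp add: algebra_simps flip: add_divide_distrib diff_divide_distrib)
  then have tx: "(1 - t) * (x + \<beta>) + t * (x - 1) = x" using assms by simp
  have "?f ((1 - t) *\<^sub>R (x + \<beta>) + t *\<^sub>R (x - 1)) \<le> (1 - t) * ?f (x + \<beta>) + t * ?f (x - 1)"
    by (rule convex_onD[OF log_convex_Gamma_real t(1,2)]) (use assms in auto)
  then have "ln (Gamma x) \<le> 1 / (1 + \<beta>) * ln (Gamma (x + \<beta>)) + \<beta> / (1 + \<beta>) * ln (Gamma (x - 1))"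
    using tx by (simp add: t(3)) (simp add: t_def)
  then have "ln (Gamma x) \<le> (ln (Gamma (x + \<beta>)) + \<beta> * ln (Gamma (x - 1))) / (1 + \<beta>)"
    by (simp add: add_divide_distrib)
  then have "(1 + \<beta>) * ln (Gamma x) \<le> ln (Gamma (x + \<beta>)) + \<beta> * ln (Gamma (x - 1))"
    using assms by (simp add: pos_le_divide_eq mult.commute)
  moreover have "Gamma x = (x - 1) * Gamma (x - 1)"
    using Gamma_plus1_pos[of "x - 1"] assms by simp
  then have "ln (Gamma x) = ln (x - 1) + ln (Gamma (x - 1))"
    using ln_mult_pos[of "x - 1" "Gamma (x - 1)"] assms G(2) by simp
  ultimately have "ln (Gamma x) + \<beta> * ln (x - 1) \<le> ln (Gamma (x + \<beta>))"
    by (simp add: algebra_simps)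
  moreover have "ln (Gamma x * (x - 1) powr \<beta>) = ln (Gamma x) + \<beta> * ln (x - 1)"
    using ln_mult_pos[of "Gamma x" "(x - 1) powr \<beta>"] assms(3) G(1) by (simp only: ln_powr) auto
  ultimately have "ln (Gamma x * (x - 1) powr \<beta>) \<le> ln (Gamma (x + \<beta>))" by simp
  moreover have "0 < Gamma x * (x - 1) powr \<beta>" using assms(3) G(1) by (intro mult_pos_pos) auto
  ultimately show ?thesis using G(3) by (metis ln_le_cancel_iff)
qed

text \<open>By the Gamma ratio bound consecutive coefficients shrink at least by the factor
  \<open>(\<beta> * real j) powr \<beta>\<close>, which tends to infinity and so eventually exceeds
  2 |x|.\<close>

lemma summable_mittag_leffler:
  assumes \<beta>: "0 < \<beta>" "\<beta> < 1"
  shows "summable (\<lambda>j. 1 / Gamma (\<beta> * real j + 1) * (x::real) ^ j)"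
proof -
  define c where "c = (\<lambda>j::nat. 1 / Gamma (\<beta> * real j + 1))"
  have cpos: "0 < c j" for j using \<beta> by (auto simp: c_def intro!: Gamma_real_pos add_nonneg_pos)
  have "filterlim (\<lambda>j. (\<beta> * real j) powr \<beta>) at_top sequentially"
    using \<beta> by real_asymp
  then have "\<forall>\<^sub>F j in sequentially. 2 * \<bar>x\<bar> \<le> (\<beta> * real j) powr \<beta> \<and> 1 \<le> j"
    using eventually_ge_at_top[of 1] by (auto simp: filterlim_at_top intro: eventually_conj)
  then obtain N where N: "\<And>j. j \<ge> N \<Longrightarrow> 2 * \<bar>x\<bar> \<le> (\<beta> * real j) powr \<beta> \<and> 1 \<le> j"
    by (auto simp: eventually_at_top_linorder)
  have "summable (\<lambda>j. c j * x ^ j)"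
  proof (rule summable_ratio_test[of "1/2" N])
    fix j assume j: "N \<le> j"
    have "Gamma (\<beta> * real j + 1) * (\<beta> * real j) powr \<beta> \<le> Gamma (\<beta> * real (Suc j) + 1)"
      using Gamma_ratio_ge[OF \<beta>, of "\<beta> * real j + 1"] N[OF j] \<beta> by (simp add: algebra_simps)
    then have "(\<beta> * real j) powr \<beta> / c j \<le> 1 / c (Suc j)"
      by (simp add: c_def mult.commute)
    then have "c (Suc j) * (\<beta> * real j) powr \<beta> \<le> c j"
      using cpos[of j] cpos[of "Suc j"] by (simp add: field_simps)
    moreover have "c (Suc j) * (2 * \<bar>x\<bar>) \<le> c (Suc j) * (\<beta> * real j) powr \<beta>"
      using N[OF j] less_imp_le[OF cpos] by (intro mult_left_mono) auto
    ultimately have "c (Suc j) * \<bar>x\<bar> \<le> 1/2 * c j" by simp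
    then have "c (Suc j) * \<bar>x\<bar> * \<bar>x\<bar> ^ j \<le> 1/2 * c j * \<bar>x\<bar> ^ j" by (intro mult_right_mono) auto
    then show "norm (c (Suc j) * x ^ Suc j) \<le> 1/2 * norm (c j * x ^ j)"
      using less_imp_le[OF cpos] by (simp add: abs_mult power_abs mult_ac)
  qed simp
  then show ?thesis by (simp add: c_def)
qed

lemma mittag_leffler_0: "mittag_leffler \<beta> 0 = 1"
  unfolding mittag_leffler_def
  using powser_sums_zero_iff[of "\<lambda>j. 1 / Gamma (\<beta> * real j + 1)" 1] by (simp add: sums_iff)

definition mittag_leffler_deriv :: "real \<Rightarrow> real \<Rightarrow> real" where
  "mittag_leffler_deriv \<beta> x = (\<Sum>j. diffs (\<lambda>j. 1 / Gamma (\<beta> * real j + 1)) j * x ^ j)"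

text \<open>The eigenfunction of the Caputo derivative of order \<beta> for the eigenvalue \<mu>,
  with value 1 at 0.\<close>

definition relaxation :: "real \<Rightarrow> real \<Rightarrow> real \<Rightarrow> real" where
  "relaxation \<beta> \<mu> s = mittag_leffler \<beta> (\<mu> * s powr \<beta>)"

text \<open>For nonzero \<mu> this blows up like \<open>s powr (\<beta> - 1)\<close> at 0, so it
  represents the derivative only for s > 0.\<close>

definition relaxation_deriv :: "real \<Rightarrow> real \<Rightarrow> real \<Rightarrow> real" where
  "relaxation_deriv \<beta> \<mu> s = mittag_leffler_deriv \<beta> (\<mu> * s powr \<beta>) * (\<mu> * (\<beta> * s powr (\<beta> - 1)))"

section \<open>The eigenfunction of the Caputo derivative\<close>

context
  fixes \<beta> :: real
  assumes \<beta>: "0 < \<beta>" "\<beta> < 1"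
begin

lemma mittag_leffler_has_derivative:
  "(mittag_leffler \<beta> has_real_derivative mittag_leffler_deriv \<beta> x) (at x)"
proof -
  have "mittag_leffler \<beta> = (\<lambda>x. \<Sum>j. 1 / Gamma (\<beta> * real j + 1) * x ^ j)"
    by (simp add: mittag_leffler_def fun_eq_iff)
  then show ?thesis
    unfolding mittag_leffler_deriv_def
    using termdiffs_strong_converges_everywhere[OF summable_mittag_leffler[OF \<beta>]] by simp
qed

lemma isCont_mittag_leffler_deriv: "isCont (mittag_leffler_deriv \<beta>) x"
  unfolding mittag_leffler_deriv_def
  by (intro isCont_powser_converges_everywhere termdiff_converges_all summable_mittag_leffler \<beta>)

text \<open>The factor \<beta> comes from differentiating \<open>s powr \<beta>\<close>. The
  resulting denominators are exactly the Gamma values that the Beta integral cancels.\<close>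

lemma diffs_mittag_leffler:
  "diffs (\<lambda>j. 1 / Gamma (\<beta> * real j + 1)) j * \<beta> = 1 / Gamma (\<beta> * real (Suc j))"
proof -
  have "0 < \<beta> * real (Suc j)" using \<beta> by simp
  then have "Gamma (\<beta> * real (Suc j) + 1) = \<beta> * real (Suc j) * Gamma (\<beta> * real (Suc j))"
    by (rule Gamma_plus1_pos)
  then show ?thesis unfolding diffs_def using \<beta> by simp
qed

lemma relaxation_has_derivative:
  assumes "0 < s"
  shows "(relaxation \<beta> \<mu> has_real_derivative relaxation_deriv \<beta> \<mu> s) (at s)"
proof -
  have "((\<lambda>s. \<mu> * s powr \<beta>) has_real_derivative \<mu> * (\<beta> * s powr (\<beta> - 1))) (at s)"
    using assms by (auto intro!: derivative_eq_intros)
  from DERIV_chain2[OF mittag_leffler_has_derivative this]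
  show ?thesis unfolding relaxation_def relaxation_deriv_def .
qed

lemma continuous_on_relaxation: "continuous_on {0..} (relaxation \<beta> \<mu>)"
proof -
  have "continuous_on UNIV (mittag_leffler \<beta>)"
    using mittag_leffler_has_derivative by (meson DERIV_isCont continuous_at_imp_continuous_on)
  moreover have "continuous_on {0..} (\<lambda>s. \<mu> * s powr \<beta>)"
    using \<beta> by (intro continuous_on_mult continuous_on_const continuous_on_powr' continuous_on_id) auto
  ultimately show ?thesis
    unfolding relaxation_def by (rule continuous_on_compose2) auto
qed

lemma isCont_relaxation_deriv:
  assumes "0 < s"
  shows "isCont (relaxation_deriv \<beta> \<mu>) s"
proof -
  have 1: "isCont (\<lambda>s. \<mu> * s powr \<beta>) s" and 2: "isCont (\<lambda>s. \<mu> * (\<beta> * s powr (\<beta> - 1))) s"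
    using assms by (auto intro!: continuous_intros)
  show ?thesis
    unfolding relaxation_deriv_def
    by (rule continuous_mult[OF isCont_o2[OF 1 isCont_mittag_leffler_deriv] 2])
qed

lemma relaxation_deriv_sums:
  assumes "0 < s"
  shows "(\<lambda>j. \<mu> ^ Suc j * s powr (\<beta> * real (Suc j) - 1) / Gamma (\<beta> * real (Suc j))) sums relaxation_deriv \<beta> \<mu> s"
proof -
  have "(\<lambda>j. diffs (\<lambda>j. 1 / Gamma (\<beta> * real j + 1)) j * (\<mu> * s powr \<beta>) ^ j) sums
      mittag_leffler_deriv \<beta> (\<mu> * s powr \<beta>)"
    unfolding mittag_leffler_deriv_def
    by (intro summable_sums termdiff_converges_all summable_mittag_leffler \<beta>)
  then have "(\<lambda>j. diffs (\<lambda>j. 1 / Gamma (\<beta> * real j + 1)) j * (\<mu> * s powr \<beta>) ^ j * (\<mu> * (\<beta> * s powr (\<beta> - 1)))) sums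
      relaxation_deriv \<beta> \<mu> s"
    unfolding relaxation_deriv_def by (rule sums_mult2)
  moreover have "diffs (\<lambda>j. 1 / Gamma (\<beta> * real j + 1)) j * (\<mu> * s powr \<beta>) ^ j * (\<mu> * (\<beta> * s powr (\<beta> - 1)))
     = \<mu> ^ Suc j * s powr (\<beta> * real (Suc j) - 1) / Gamma (\<beta> * real (Suc j))" for j
  proof -
    have e: "(s powr \<beta>) ^ j * s powr (\<beta> - 1) = s powr (\<beta> * real (Suc j) - 1)"
      using assms by (simp add: powr_power flip: powr_add) (simp add: algebra_simps)
    have "diffs (\<lambda>j. 1 / Gamma (\<beta> * real j + 1)) j * (\<mu> * s powr \<beta>) ^ j * (\<mu> * (\<beta> * s powr (\<beta> - 1)))
      = (diffs (\<lambda>j. 1 / Gamma (\<beta> * real j + 1)) j * \<beta>) * (\<mu> ^ Suc j * s powr (\<beta> * real (Suc j) - 1))"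
      unfolding e[symmetric] power_mult_distrib by (simp only: power_Suc mult_ac)
    also have "\<dots> = \<mu> ^ Suc j * s powr (\<beta> * real (Suc j) - 1) / Gamma (\<beta> * real (Suc j))"
      unfolding diffs_mittag_leffler by simp
    finally show ?thesis .
  qed
  ultimately show ?thesis by simp
qed

text \<open>Integrated against the kernel, the power
  \<open>t powr (\<beta> * real (Suc j) - 1)\<close> over its Gamma value becomes \<Gamma>(1 -
  \<beta>) times the j-th Mittag-Leffler term. The index drops by one, one factor \<mu> remains, and
  the same series reappears.\<close>

lemma caputo_relaxation:
  assumes s: "0 < s"
  shows "(\<lambda>t. (s - t) powr (- \<beta>) * relaxation_deriv \<beta> \<mu> t) absolutely_integrable_on {0..s}"
    and "((\<lambda>t. (s - t) powr (- \<beta>) * relaxation_deriv \<beta> \<mu> t) has_integral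
      Gamma (1 - \<beta>) * \<mu> * relaxation \<beta> \<mu> s) {0..s}"
proof -
  define h where "h = (\<lambda>j t. if t \<in> {0<..<s} then
    (s - t) powr (- \<beta>) * (t powr (\<beta> * real (Suc j) - 1) / Gamma (\<beta> * real (Suc j))) else 0)"
  define I where "I = (\<lambda>j. Gamma (1 - \<beta>) * (s powr \<beta>) ^ j / Gamma (\<beta> * real j + 1))"
  have Gpos: "0 < Gamma (\<beta> * real (Suc j))" "0 < Gamma (\<beta> * real j + 1)" for j
    using \<beta> by (auto intro!: Gamma_real_pos add_nonneg_pos simp del: of_nat_Suc)
  have h: "has_bochner_integral lborel (h j) (I j)" for j
  proof (rule has_bochner_integral_of_nonneg_has_integral)
    let ?y = "\<beta> * real (Suc j)"
    have "((\<lambda>t. (s - t) powr ((1 - \<beta>) - 1) * (t - 0) powr (?y - 1)) has_integral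
        Beta (1 - \<beta>) ?y * (s - 0) powr ((1 - \<beta>) + ?y - 1)) {0..s}"
      using \<beta> s by (intro has_integral_Beta_interval) auto
    from has_integral_divide[OF this, of "Gamma ?y"]
    have "((\<lambda>t. (s - t) powr (- \<beta>) * (t powr (?y - 1) / Gamma ?y)) has_integral
        Beta (1 - \<beta>) ?y * s powr (\<beta> * real j) / Gamma ?y) {0<..<s}"
      by (simp add: has_integral_Icc_iff_Ioo algebra_simps)
    moreover have y: "1 - \<beta> + ?y = \<beta> * real j + 1" by (simp add: algebra_simps)
    have "Beta (1 - \<beta>) ?y * s powr (\<beta> * real j) / Gamma ?y = I j"
      unfolding Beta_def y I_def using Gpos(1)[of j] s
      by (simp add: powr_power mult.commute del: of_nat_Suc)
    ultimately show "(h j has_integral I j) UNIV"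
      unfolding h_def has_integral_restrict_UNIV by simp
  qed (use Gpos(1) in \<open>auto simp: h_def less_imp_le simp del: of_nat_Suc\<close>)
  define f where "f = (\<lambda>j t. \<mu> ^ Suc j * h j t)"
  have f_int: "has_bochner_integral lborel (f j) (\<mu> ^ Suc j * I j)" for j
    unfolding f_def by (intro has_bochner_integral_mult_right h)
  have hnn: "0 \<le> h j t" for j t using Gpos(1)[of j] by (auto simp: h_def less_imp_le)
  have f_norm: "has_bochner_integral lborel (\<lambda>t. norm (f j t)) (\<bar>\<mu>\<bar> ^ Suc j * I j)" for j
  proof -
    have "(\<lambda>t. norm (f j t)) = (\<lambda>t. \<bar>\<mu>\<bar> ^ Suc j * h j t)"
      using hnn by (simp add: f_def abs_mult power_abs)
    then show ?thesis using h by (simp only:) (intro has_bochner_integral_mult_right h)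
  qed
  \<comment> \<open>Stated for arbitrary l because it is used twice: with \<mu> for the value of the
    integral, and with |\<mu>| for the sum of the norms that justifies termwise integration.\<close>
  have I_sums: "(\<lambda>j. l ^ Suc j * I j) sums (Gamma (1 - \<beta>) * l * relaxation \<beta> l s)" for l
  proof -
    have "(\<lambda>j. 1 / Gamma (\<beta> * real j + 1) * (l * s powr \<beta>) ^ j) sums relaxation \<beta> l s"
      using summable_sums[OF summable_mittag_leffler[OF \<beta>, of "l * s powr \<beta>"]]
      by (simp add: relaxation_def mittag_leffler_def)
    from sums_mult[OF this, of "Gamma (1 - \<beta>) * l"] show ?thesis
      by (simp add: I_def power_mult_distrib mult_ac)
  qed
  have f_sums: "(\<lambda>j. f j t) sums (if t \<in> {0<..<s} then (s - t) powr (- \<beta>) * relaxation_deriv \<beta> \<mu> t else 0)"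
    and f_abs: "summable (\<lambda>j. norm (f j t))" for t
  proof -
    have *: "(\<lambda>j. l ^ Suc j * h j t) sums ((s - t) powr (- \<beta>) * relaxation_deriv \<beta> l t)" if "t \<in> {0<..<s}" for l
      using sums_mult[OF relaxation_deriv_sums[of t l], of "(s - t) powr (- \<beta>)"] that
      by (simp add: h_def mult_ac del: of_nat_Suc power_Suc)
    show "(\<lambda>j. f j t) sums (if t \<in> {0<..<s} then (s - t) powr (- \<beta>) * relaxation_deriv \<beta> \<mu> t else 0)"
    proof (cases "t \<in> {0<..<s}")
      case False
      then have "(\<lambda>j. f j t) = (\<lambda>_. 0)" by (auto simp: f_def h_def)
      then show ?thesis using False by auto
    qed (use *[of \<mu>] in \<open>simp add: f_def\<close>)
    have "norm (f j t) = \<bar>\<mu>\<bar> ^ Suc j * h j t" for j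
      using hnn by (simp add: f_def abs_mult power_abs)
    moreover have "summable (\<lambda>j. \<bar>\<mu>\<bar> ^ Suc j * h j t)"
    proof (cases "t \<in> {0<..<s}")
      case True
      from *[OF this] show ?thesis by (rule sums_summable)
    next
      case False
      then have "(\<lambda>j. \<bar>\<mu>\<bar> ^ Suc j * h j t) = (\<lambda>_. 0)" by (auto simp: h_def)
      then show ?thesis by simp
    qed
    ultimately show "summable (\<lambda>j. norm (f j t))" by simp
  qed
  let ?g = "\<lambda>t. (s - t) powr (- \<beta>) * relaxation_deriv \<beta> \<mu> t"
  let ?G = "\<lambda>t. if t \<in> {0<..<s} then ?g t else 0"
  have int: "integrable lborel (f j)" for j using f_int by (simp add: has_bochner_integral_iff)
  have ae: "AE t in lborel. summable (\<lambda>j. norm (f j t))" using f_abs by simp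
  have sm: "summable (\<lambda>j. \<integral>t. norm (f j t) \<partial>lborel)"
    using sums_summable[OF I_sums[of "\<bar>\<mu>\<bar>"]] has_bochner_integral_integral_eq[OF f_norm] by simp
  have G: "(\<lambda>t. \<Sum>j. f j t) = ?G" using f_sums by (auto simp: sums_iff)
  have Gint: "integrable lborel ?G" using integrable_suminf[OF int ae sm] unfolding G .
  have "integral\<^sup>L lborel ?G = Gamma (1 - \<beta>) * \<mu> * relaxation \<beta> \<mu> s"
    using sums_integral[OF int ae sm] I_sums[of \<mu>]
    unfolding G has_bochner_integral_integral_eq[OF f_int] by (rule sums_unique2)
  then have "(?G has_integral Gamma (1 - \<beta>) * \<mu> * relaxation \<beta> \<mu> s) UNIV"
    using has_integral_integral_lborel[OF Gint] by simp
  then show *: "(?g has_integral Gamma (1 - \<beta>) * \<mu> * relaxation \<beta> \<mu> s) {0..s}"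
    unfolding has_integral_restrict_UNIV by (simp add: has_integral_Icc_iff_Ioo)
  have "((\<lambda>t. norm (?G t)) has_integral integral\<^sup>L lborel (\<lambda>t. norm (?G t))) UNIV"
    by (intro has_integral_integral_lborel integrable_norm Gint)
  also have "(\<lambda>t. norm (?G t)) = (\<lambda>t. if t \<in> {0<..<s} then norm (?g t) else 0)" by auto
  finally have "(\<lambda>t. norm (?g t)) integrable_on {0..s}"
    unfolding has_integral_restrict_UNIV integrable_on_open_interval_real[symmetric]
    by (rule has_integral_integrable)
  with * show "?g absolutely_integrable_on {0..s}" by (intro absolutely_integrable_onI) auto
qed

end

subsection \<open>The price adjustment equation\<close>

context fractal
begin

lemma solution_imp_volterra:
  assumes \<beta>: "0 < \<beta>" "\<beta> < 1"
    and sol: "price_adjustment_solution \<alpha> F \<beta> d0 d1 d2 s0 s1 s2 p"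
  shows "\<exists>q. (\<forall>r>0. q absolutely_integrable_on {0..r}) \<and> (\<forall>r>0. (q has_integral p r - p 0) {0..r}) \<and>
    (\<forall>s>0. ((\<lambda>t. (s - t) powr (- \<beta>) * q t) has_integral
      Gamma (1 - \<beta>) * ((d1 + s1) / (d2 + s2) * p s - (d0 + s0) / (d2 + s2))) {0..s})"
proof -
  define q where "q = (\<lambda>s. F_deriv \<alpha> F (\<lambda>u. p (S u)) (upper_inv s))"
  have cont: "continuous_on {0..} p"
    and F_diff: "\<And>t. t \<in> F \<Longrightarrow> 0 < S t \<Longrightarrow> F_differentiable \<alpha> F (\<lambda>u. p (S u)) t"
    and F_cont: "\<And>t. t \<in> F \<Longrightarrow> 0 < S t \<Longrightarrow> continuous (at t within F) (F_deriv \<alpha> F (\<lambda>u. p (S u)))"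
    and F_int: "\<And>t. 0 \<le> t \<Longrightarrow> 0 < S t \<Longrightarrow> absolutely_F_integrable \<alpha> F (caputo_integrand \<alpha> F \<beta> p t) 0 t"
    and equation: "\<And>t. 0 \<le> t \<Longrightarrow> 0 < S t \<Longrightarrow>
       caputo_deriv \<alpha> F \<beta> p t - (d1 + s1) / (d2 + s2) * p (S t) = - ((d0 + s0) / (d2 + s2))"
    using sol unfolding price_adjustment_solution_def by blast+
  have ker_abs: "(\<lambda>t. (s - t) powr (- \<beta>) * q t) absolutely_integrable_on {0..s}"
    and ker: "((\<lambda>t. (s - t) powr (- \<beta>) * q t) has_integral
      Gamma (1 - \<beta>) * ((d1 + s1) / (d2 + s2) * p s - (d0 + s0) / (d2 + s2))) {0..s}" if s: "0 < s" for s
  proof -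
    \<comment> \<open>Every s > 0 is a value of S, so the equation, posed at times t, is available
      at every s.\<close>
    define t where "t = upper_inv s"
    have t: "0 \<le> t" "S t = s" using s upper_inv_nonneg[of s] by (auto simp: t_def)
    have eq: "caputo_integrand \<alpha> F \<beta> p t (upper_inv x) = (s - x) powr (- \<beta>) * q x" if "x \<in> {0..s}" for x
      using that t by (simp add: caputo_integrand_def q_def)
    have "0 < S t" using t s by simp
    note imp = absolutely_F_integrable_imp[OF F_int[OF t(1) this] order_refl, unfolded staircase_0 t(2)]
    show *: "(\<lambda>t. (s - t) powr (- \<beta>) * q t) absolutely_integrable_on {0..s}"
      using imp(1) by (rule absolutely_integrable_spike[of _ _ "{}"]) (use eq in auto)
    have "F_integral \<alpha> F (caputo_integrand \<alpha> F \<beta> p t) 0 t = integral {0..s} (\<lambda>t. (s - t) powr (- \<beta>) * q t)"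
      unfolding imp(3) by (rule Henstock_Kurzweil_Integration.integral_cong) (rule eq)
    moreover have "0 < Gamma (1 - \<beta>)" using \<beta> by (intro Gamma_real_pos) auto
    moreover have "caputo_deriv \<alpha> F \<beta> p t - (d1 + s1) / (d2 + s2) * p s = - ((d0 + s0) / (d2 + s2))"
      using equation[of t] t s by simp
    ultimately have "integral {0..s} (\<lambda>t. (s - t) powr (- \<beta>) * q t) =
      Gamma (1 - \<beta>) * ((d1 + s1) / (d2 + s2) * p s - (d0 + s0) / (d2 + s2))"
      unfolding caputo_deriv_def by (simp add: field_simps)
    with * show "((\<lambda>t. (s - t) powr (- \<beta>) * q t) has_integral
      Gamma (1 - \<beta>) * ((d1 + s1) / (d2 + s2) * p s - (d0 + s0) / (d2 + s2))) {0..s}"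
      by (simp add: has_integral_iff set_lebesgue_integral_eq_integral(1))
  qed
  \<comment> \<open>The kernel at s = r is undone by the bounded factor
    \<open>(r - t) powr \<beta>\<close>; the product of the two powers is 1 except at t = r.\<close>
  have q_abs: "q absolutely_integrable_on {0..r}" if r: "0 < r" for r
  proof -
    have c: "continuous_on {0..r} (\<lambda>t. (r - t) powr \<beta>)"
      using \<beta> by (intro continuous_on_powr' continuous_on_diff continuous_on_const continuous_on_id) auto
    have "(\<lambda>t. (r - t) powr \<beta> * ((r - t) powr (- \<beta>) * q t)) absolutely_integrable_on {0..r}"
    proof (rule absolutely_integrable_bounded_measurable_product_real[OF _ _ _ ker_abs[OF r]])
      show "(\<lambda>t. (r - t) powr \<beta>) \<in> borel_measurable (lebesgue_on {0..r})"
        by (rule continuous_imp_measurable_on_sets_lebesgue[OF c]) auto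
      show "bounded ((\<lambda>t. (r - t) powr \<beta>) ` {0..r})"
        by (intro compact_imp_bounded compact_continuous_image c) auto
    qed auto
    then show ?thesis
      by (rule absolutely_integrable_spike[of _ _ "{r}"]) (auto simp: powr_minus field_simps)
  qed
  have "(q has_integral p r - p 0) {0..r}" if r: "0 < r" for r
  proof -
    have int: "q integrable_on {0..r}" using q_abs[OF r] by (rule set_lebesgue_integral_eq_integral(1))
    \<comment> \<open>Off the gap values p has derivative q, and F-continuity of the F-derivative
      makes q continuous there, so the indefinite integral has the same derivative and g has
      derivative 0.\<close>
    define g where "g = (\<lambda>x. p x - integral {0..x} q)"
    have "g 0 = g r"
    proof (rule constant_of_countable_exceptions[of 0 r g, OF _ _ countable_gap_values])
      show "continuous_on {0..r} g"
        unfolding g_def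
        by (intro continuous_on_diff indefinite_integral_continuous_1 int continuous_on_subset[OF cont]) auto
      fix x assume x: "0 < x" "x < r" "x \<notin> gap_values"
      have ux: "upper_inv x \<in> F" "S (upper_inv x) = x" using x upper_inv_in_F[of x] by auto
      have dp: "(p has_real_derivative q x) (at x)"
        unfolding q_def by (intro F_differentiable_imp_derivative F_diff x) (use ux x in auto)
      have "(F_deriv \<alpha> F (\<lambda>u. p (S u)) \<longlongrightarrow> q x) (at (upper_inv x) within F)"
        unfolding q_def using F_cont[of "upper_inv x"] ux x by (simp add: continuous_within)
      from filterlim_compose[OF this filterlim_upper_inv[OF x(1,3)]]
      have "isCont q x" by (simp add: isCont_def q_def)
      then have "continuous (at x within ({0..r} - {})) q" using continuous_within_subset by blast
      from integral_has_vector_derivative_continuous_at[OF int _ _ this]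
      have "((\<lambda>u. integral {0..u} q) has_vector_derivative q x) (at x within {0..r})" using x by simp
      then have "((\<lambda>u. integral {0..u} q) has_real_derivative q x) (at x)"
        using x at_within_interior[of x "{0..r}"]
        by (simp add: has_real_derivative_iff_has_vector_derivative)
      from DERIV_diff[OF dp this] show "(g has_real_derivative 0) (at x)" by (simp add: g_def)
    qed (use r in auto)
    then show ?thesis using int by (simp add: has_integral_iff g_def)
  qed
  then show ?thesis using q_abs ker by blast
qed

lemma solution_unique:
  assumes \<beta>: "0 < \<beta>" "\<beta> < 1"
    and sol: "price_adjustment_solution \<alpha> F \<beta> d0 d1 d2 s0 s1 s2 p"
      "price_adjustment_solution \<alpha> F \<beta> d0 d1 d2 s0 s1 s2 P"
    and "p 0 = P 0" "0 \<le> r"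
  shows "p r = P r"
proof -
  let ?\<mu> = "(d1 + s1) / (d2 + s2)"
  obtain q where q: "\<forall>r>0. q absolutely_integrable_on {0..r}"
    "\<forall>r>0. (q has_integral p r - p 0) {0..r}"
    "\<forall>s>0. ((\<lambda>t. (s - t) powr (- \<beta>) * q t) has_integral
      Gamma (1 - \<beta>) * (?\<mu> * p s - (d0 + s0) / (d2 + s2))) {0..s}"
    using solution_imp_volterra[OF \<beta> sol(1)] by (elim exE conjE)
  obtain Q where Q: "\<forall>r>0. Q absolutely_integrable_on {0..r}"
    "\<forall>r>0. (Q has_integral P r - P 0) {0..r}"
    "\<forall>s>0. ((\<lambda>t. (s - t) powr (- \<beta>) * Q t) has_integral
      Gamma (1 - \<beta>) * (?\<mu> * P s - (d0 + s0) / (d2 + s2))) {0..s}"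
    using solution_imp_volterra[OF \<beta> sol(2)] by (elim exE conjE)
  have "p r - P r = 0"
  proof (rule caputo_equation_zero[OF \<beta>, where u = "\<lambda>r. p r - P r" and v = "\<lambda>t. q t - Q t"
        and C = "Gamma (1 - \<beta>) * ?\<mu>"])
    show "continuous_on {0..} (\<lambda>r. p r - P r)"
      using sol unfolding price_adjustment_solution_def by (intro continuous_on_diff) auto
    fix s :: real assume s: "0 < s"
    show "(\<lambda>t. q t - Q t) absolutely_integrable_on {0..s}"
      using q(1) Q(1) s by (intro set_integral_diff) auto
    show "((\<lambda>t. q t - Q t) has_integral p s - P s) {0..s}"
      using has_integral_diff[OF q(2)[rule_format, OF s] Q(2)[rule_format, OF s]] assms(5) by simp
    show "((\<lambda>t. (s - t) powr (- \<beta>) * (q t - Q t)) has_integral Gamma (1 - \<beta>) * ?\<mu> * (p s - P s)) {0..s}"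
      using has_integral_diff[OF q(3)[rule_format, OF s] Q(3)[rule_format, OF s]] by (simp add: right_diff_distrib mult.assoc)
  qed (use assms in auto)
  then show ?thesis by simp
qed

text \<open>The constant (d0 + s0) / (d1 + s1) is the equilibrium price: its derivative vanishes and
  it accounts for the right-hand side. The multiple of the eigenfunction solves the homogeneous
  equation for any A.\<close>

lemma relaxation_solution:
  assumes \<beta>: "0 < \<beta>" "\<beta> < 1" and ne: "d1 + s1 \<noteq> 0" "d2 + s2 \<noteq> 0"
  defines "\<mu> \<equiv> (d1 + s1) / (d2 + s2)"
  shows "price_adjustment_solution \<alpha> F \<beta> d0 d1 d2 s0 s1 s2
    (\<lambda>s. A * relaxation \<beta> \<mu> s + (d0 + s0) / (d1 + s1))"
proof -
  let ?P = "\<lambda>s. A * relaxation \<beta> \<mu> s + (d0 + s0) / (d1 + s1)"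
  let ?D = "\<lambda>s. A * relaxation_deriv \<beta> \<mu> s"
  have der: "(?P has_real_derivative ?D s) (at s)" if "0 < s" for s
    by (auto intro!: derivative_eq_intros relaxation_has_derivative \<beta> that)
  have Dcont: "isCont ?D s" if "0 < s" for s
    by (intro continuous_mult continuous_const isCont_relaxation_deriv \<beta> that)
  have F_diff: "F_differentiable \<alpha> F (\<lambda>u. ?P (S u)) t" and F_der: "F_deriv \<alpha> F (\<lambda>u. ?P (S u)) t = ?D (S t)"
    if "t \<in> F" "0 < S t" for t
    using F_derivative_composition[OF that der[OF that(2)]] by auto
  have F_cont: "continuous (at t within F) (F_deriv \<alpha> F (\<lambda>u. ?P (S u)))" if t: "t \<in> F" "0 < S t" for t
  proof -
    have St: "(S \<longlongrightarrow> S t) (at t within F)"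
      using filterlim_staircase_at[OF t(1)] by (simp add: filterlim_at)
    have "((\<lambda>y. ?D (S y)) \<longlongrightarrow> ?D (S t)) (at t within F)"
      by (rule isCont_tendsto_compose[OF Dcont[OF t(2)] St])
    moreover have "\<forall>\<^sub>F y in at t within F. y \<in> F" by (simp add: eventually_at_filter)
    with order_tendstoD(1)[OF St t(2)]
    have "\<forall>\<^sub>F y in at t within F. ?D (S y) = F_deriv \<alpha> F (\<lambda>u. ?P (S u)) y"
      by eventually_elim (use F_der in auto)
    ultimately show ?thesis
      unfolding continuous_within F_der[OF t] by (rule Lim_transform_eventually)
  qed
  \<comment> \<open>The transported integrand is continuous inside (0, S t) but may be singular at
    both ends, so the integrals of the integrand and of its absolute value are obtained as improper
    ones.\<close>
  have caputo: "absolutely_F_integrable \<alpha> F (caputo_integrand \<alpha> F \<beta> ?P t) 0 t"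
      "F_integral \<alpha> F (caputo_integrand \<alpha> F \<beta> ?P t) 0 t = A * (Gamma (1 - \<beta>) * \<mu> * relaxation \<beta> \<mu> (S t))"
    if t: "0 \<le> t" "0 < S t" for t
  proof -
    let ?f = "\<lambda>x. (S t - x) powr (- \<beta>) * ?D x"
    let ?h = "caputo_integrand \<alpha> F \<beta> ?P t"
    have f_eq: "?f = (\<lambda>x. A * ((S t - x) powr (- \<beta>) * relaxation_deriv \<beta> \<mu> x))"
      by (simp add: fun_eq_iff)
    have int: "(?f has_integral A * (Gamma (1 - \<beta>) * \<mu> * relaxation \<beta> \<mu> (S t))) {0..S t}"
      unfolding f_eq by (intro has_integral_mult_right caputo_relaxation \<beta> t)
    have abs: "?f absolutely_integrable_on {0..S t}"
      unfolding f_eq by (intro set_integrable_mult_right caputo_relaxation \<beta> t)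
    have c: "continuous_on {0<..<S t} ?f"
    proof (rule continuous_at_imp_continuous_on, intro ballI)
      fix x assume "x \<in> {0<..<S t}"
      then show "isCont ?f x" by (intro continuous_mult[OF _ Dcont]) (auto intro!: continuous_intros)
    qed
    have h: "?h y = ?f (S y)" if "y \<in> F" "0 < S y" for y
      using F_der[OF that] by (simp add: caputo_integrand_def)
    have I1: "has_F_integral \<alpha> F ?h 0 t (integral {0..S t} ?f)"
      unfolding has_F_integral_def
      by (intro disjI2 has_improper_F_integralI t c has_integral_integrable[OF int] h)
    have "has_F_integral \<alpha> F (\<lambda>y. \<bar>?h y\<bar>) 0 t (integral {0..S t} (\<lambda>x. \<bar>?f x\<bar>))"
      unfolding has_F_integral_def
    proof (intro disjI2 has_improper_F_integralI t)
      show "continuous_on {0<..<S t} (\<lambda>x. \<bar>?f x\<bar>)" by (intro continuous_on_rabs c)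
      show "(\<lambda>x. \<bar>?f x\<bar>) integrable_on {0..S t}"
        using abs unfolding absolutely_integrable_on_def by simp
    qed (simp only: h)
    with I1 show *: "absolutely_F_integrable \<alpha> F ?h 0 t"
      unfolding absolutely_F_integrable_def by blast
    have "F_integral \<alpha> F ?h 0 t = integral {0..S t} ?f"
      using absolutely_F_integrable_imp(2)[OF * order_refl I1] absolutely_F_integrable_imp(3)[OF * order_refl]
      by (simp add: integral_unique)
    then show "F_integral \<alpha> F ?h 0 t = A * (Gamma (1 - \<beta>) * \<mu> * relaxation \<beta> \<mu> (S t))"
      using integral_unique[OF int] by simp
  qed
  have G: "0 < Gamma (1 - \<beta>)" using \<beta> by (intro Gamma_real_pos) auto
  have "caputo_deriv \<alpha> F \<beta> ?P t - \<mu> * ?P (S t) = - ((d0 + s0) / (d2 + s2))" if "0 \<le> t" "0 < S t" for t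
  proof -
    have "caputo_deriv \<alpha> F \<beta> ?P t = \<mu> * (A * relaxation \<beta> \<mu> (S t))"
      unfolding caputo_deriv_def caputo(2)[OF that] using G by simp
    moreover have "\<mu> * ((d0 + s0) / (d1 + s1)) = (d0 + s0) / (d2 + s2)"
      using ne by (simp add: \<mu>_def)
    ultimately show ?thesis by (simp add: distrib_left)
  qed
  moreover have "continuous_on {0..} ?P"
    by (intro continuous_on_add continuous_on_mult continuous_on_const continuous_on_relaxation \<beta>)
  ultimately show ?thesis
    unfolding price_adjustment_solution_def \<mu>_def[symmetric] using F_diff F_cont caputo(1) by blast
qed

end

theorem mainTheorem4:
  fixes \<alpha> \<beta> d0 d1 d2 s0 s1 s2 p0 :: real and F :: "real set"
  assumes "0 < \<alpha>" and "\<alpha> \<le> 1"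
    and "admissible_fractal \<alpha> F"
    and "0 < \<beta>" and "\<beta> < 1"
    and "d2 \<ge> 0" and "s2 \<ge> 0"
    and "d1 + s1 \<noteq> 0" and "d2 + s2 \<noteq> 0"
  shows "\<exists>P. price_adjustment_solution \<alpha> F \<beta> d0 d1 d2 s0 s1 s2 P \<and> P 0 = p0 \<and>
    (\<forall>t\<ge>0. P (staircase \<alpha> F t) =
        p0 * mittag_leffler \<beta> ((d1 + s1) / (d2 + s2) * staircase \<alpha> F t powr \<beta>)
        + (d0 + s0) / (d1 + s1)
          * (1 - mittag_leffler \<beta> ((d1 + s1) / (d2 + s2) * staircase \<alpha> F t powr \<beta>))) \<and>
    (\<forall>p. price_adjustment_solution \<alpha> F \<beta> d0 d1 d2 s0 s1 s2 p \<and> p 0 = p0 \<longrightarrow>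
        (\<forall>s\<ge>0. p s = P s))"
proof -
  interpret fractal \<alpha> F by standard (use assms in auto)
  let ?\<mu> = "(d1 + s1) / (d2 + s2)"
  \<comment> \<open>The amplitude is the initial deviation from equilibrium, since the eigenfunction
    equals 1 at 0.\<close>
  let ?P = "\<lambda>s. (p0 - (d0 + s0) / (d1 + s1)) * relaxation \<beta> ?\<mu> s + (d0 + s0) / (d1 + s1)"
  have sol: "price_adjustment_solution \<alpha> F \<beta> d0 d1 d2 s0 s1 s2 ?P"
    by (rule relaxation_solution) (use assms in auto)
  have P0: "?P 0 = p0" by (simp add: relaxation_def mittag_leffler_0)
  show ?thesis
  proof (intro exI[of _ ?P] conjI allI impI sol P0)
    fix t :: real
    show "?P (S t) = p0 * mittag_leffler \<beta> (?\<mu> * S t powr \<beta>)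
      + (d0 + s0) / (d1 + s1) * (1 - mittag_leffler \<beta> (?\<mu> * S t powr \<beta>))"
      by (simp add: relaxation_def left_diff_distrib right_diff_distrib)
  next
    fix p s assume "price_adjustment_solution \<alpha> F \<beta> d0 d1 d2 s0 s1 s2 p \<and> p 0 = p0" "0 \<le> (s::real)"
    then show "p s = ?P s" using solution_unique[OF assms(4,5) _ sol] P0 by auto
  qed
qed

end
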